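(* Fix $\delta\in(0,1/4)$ and $\epsilon_{\max}\in(1/3,1/2)$, and assume that $\sigma^2>0$ is unknown. There is a constant $c>0$ depending only on $\delta$ and $\epsilon_{\max}$ such that the following holds. For any confidence interval $\widehat{\mathrm{CI}}$ (computed from $n$ i.i.d. observations, using neither $\sigma$ nor $\varepsilon$) and any function $r(n,\sigma,\varepsilon)$ that satisfy $$\inf_{\theta\in\mathbb R,\,\sigma^2>0}\ \inf_{\varepsilon\in[0,\epsilon_{\max}],\,Q}P^n_{\theta,\sigma,\varepsilon,Q}\big(\theta\in\widehat{\mathrm{CI}}\big)\ge1-\delta,\qquad \inf_{\theta\in\mathbb R,\,\sigma^2>0}\ \inf_{\varepsilon\in[0,\epsilon_{\max}],\,Q}P^n_{\theta,\sigma,\varepsilon,Q}\big(|\widehat{\mathrm{CI}}|\le r(n,\sigma,\varepsilon)\big)\ge1-\delta,$$ it must hold that $$r(n,\sigma,\varepsilon)\ \ge\ \begin{cases}c\,\sigma\, n^{-1/16}, & \text{if }\epsilon_{\max}\in(1/3,7/15],\\ c\,\sigma\, n^{-1/24}, & \text{if }\epsilon_{\max}\in(7/15,1/2),\end{cases}$$ for all $(n,\sigma,\varepsilon)$ with $\varepsilon\in[0,\epsilon_{\max}]$.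
   Context: For $I\subseteq\mathbb R$, $|I|=\sup I-\inf I$ denotes its diameter (length). Model (Efron's Gaussian two-groups model). For $\theta\in\mathbb R$, $\sigma>0$, $\varepsilon\in[0,1/2)$ and $Q$ an arbitrary probability distribution on $\mathbb R$, $$P_{\theta,\sigma,\varepsilon,Q}=(1-\varepsilon)\,\mathcal N(\theta,\sigma^2)+\varepsilon\, Q*\mathcal N(0,\sigma^2),$$ and $P^n_{\theta,\sigma,\varepsilon,Q}$ is the law of i.i.d. $X_1,\dots,X_n\sim P_{\theta,\sigma,\varepsilon,Q}$. Infima over $Q$ range over all probability distributions on $\mathbb R$. *)

theory Defs
  imports "HOL-Probability.Probability"
begin

definition gauss :: "real \<Rightarrow> real \<Rightarrow> real measure" where
  "gauss \<theta> \<sigma> = density lborel (normal_density \<theta> \<sigma>)"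

definition mixture :: "real \<Rightarrow> 'a measure \<Rightarrow> 'a measure \<Rightarrow> 'a measure" where
  "mixture \<epsilon> M N = measure_of (space M) (sets M)
     (\<lambda>A. ennreal (1 - \<epsilon>) * emeasure M A + ennreal \<epsilon> * emeasure N A)"

definition two_groups :: "real \<Rightarrow> real \<Rightarrow> real \<Rightarrow> real measure \<Rightarrow> real measure" where
  "two_groups \<theta> \<sigma> \<epsilon> Q = mixture \<epsilon> (gauss \<theta> \<sigma>) (convolution Q (gauss 0 \<sigma>))"

text \<open>A sample of size \<open>n\<close> is a function on the index set \<open>{..<n}\<close>, extended by \<open>undefined\<close>.\<close>

definition two_groups_sample ::
    "nat \<Rightarrow> real \<Rightarrow> real \<Rightarrow> real \<Rightarrow> real measure \<Rightarrow> (nat \<Rightarrow> real) measure" where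
  "two_groups_sample n \<theta> \<sigma> \<epsilon> Q = (\<Pi>\<^sub>M i\<in>{..<n}. two_groups \<theta> \<sigma> \<epsilon> Q)"

text \<open>The length takes values in the extended reals because an interval may be unbounded
  (length \<open>\<infinity>\<close>). For the empty set the formula gives \<open>-\<infinity>\<close>.\<close>

definition interval_length :: "real set \<Rightarrow> ereal" where
  "interval_length I = (SUP x\<in>I. ereal x) - (INF x\<in>I. ereal x)"

text \<open>The data are the only argument of the procedure, so it cannot depend on the parameters
  \<open>\<sigma>\<close> and \<open>\<epsilon>\<close>. The last two conjuncts make coverage and length events.\<close>

definition confidence_interval :: "nat \<Rightarrow> ((nat \<Rightarrow> real) \<Rightarrow> real set) \<Rightarrow> bool" where
  "confidence_interval n CI \<longleftrightarrow>
     (\<forall>x\<in>space (\<Pi>\<^sub>M i\<in>{..<n}. borel). is_interval (CI x)) \<and>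
     (\<forall>\<theta>. {x \<in> space (\<Pi>\<^sub>M i\<in>{..<n}. borel). \<theta> \<in> CI x} \<in> sets (\<Pi>\<^sub>M i\<in>{..<n}. borel)) \<and>
     (\<lambda>x. interval_length (CI x)) \<in> borel_measurable (\<Pi>\<^sub>M i\<in>{..<n}. borel)"

lemma emeasure_mixture:
  assumes "sets N = sets M" and "A \<in> sets M"
  shows "emeasure (mixture \<epsilon> M N) A = ennreal (1 - \<epsilon>) * emeasure M A + ennreal \<epsilon> * emeasure N A"
  unfolding mixture_def
proof (rule emeasure_measure_of_sigma)
  show "countably_additive (sets M)
      (\<lambda>A. ennreal (1 - \<epsilon>) * emeasure M A + ennreal \<epsilon> * emeasure N A)"
  proof (rule countably_additiveI)
    fix F :: "nat \<Rightarrow> _" assume F: "range F \<subseteq> sets M" "disjoint_family F"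
    show "(\<Sum>i. ennreal (1 - \<epsilon>) * emeasure M (F i) + ennreal \<epsilon> * emeasure N (F i)) =
        ennreal (1 - \<epsilon>) * emeasure M (\<Union> (range F)) + ennreal \<epsilon> * emeasure N (\<Union> (range F))"
      using F assms(1)
      by (simp add: suminf_add[symmetric] ennreal_suminf_cmult suminf_emeasure)
  qed
qed (use assms in \<open>auto simp: positive_def sets.sigma_algebra_axioms\<close>)

lemma space_mixture [simp]: "space (mixture \<epsilon> M N) = space M"
  by (simp add: mixture_def space_measure_of_conv)

lemma sets_mixture [simp, measurable_cong]: "sets (mixture \<epsilon> M N) = sets M"
  by (simp add: mixture_def)

lemma prob_space_mixture:
  assumes "prob_space M" "prob_space N" "sets N = sets M" "0 \<le> \<epsilon>" "\<epsilon> \<le> 1"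
  shows "prob_space (mixture \<epsilon> M N)"
proof (rule prob_spaceI)
  have "space N = space M"
    using assms(3) by (rule sets_eq_imp_space_eq)
  then have "emeasure (mixture \<epsilon> M N) (space M) = ennreal (1 - \<epsilon>) + ennreal \<epsilon>"
    using assms prob_space.emeasure_space_1[of M] prob_space.emeasure_space_1[of N]
    by (simp add: emeasure_mixture)
  also have "\<dots> = 1"
    using assms by (simp flip: ennreal_plus)
  finally show "emeasure (mixture \<epsilon> M N) (space (mixture \<epsilon> M N)) = 1"
    by simp
qed

lemma sets_gauss [simp, measurable_cong]: "sets (gauss \<theta> \<sigma>) = sets borel"
  by (simp add: gauss_def)

lemma prob_space_gauss: "0 < \<sigma> \<Longrightarrow> prob_space (gauss \<theta> \<sigma>)"
  unfolding gauss_def by (rule prob_space_normal_density)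

lemma sets_two_groups [simp, measurable_cong]: "sets (two_groups \<theta> \<sigma> \<epsilon> Q) = sets borel"
  by (simp add: two_groups_def)

lemma prob_space_two_groups:
  assumes "0 < \<sigma>" "0 \<le> \<epsilon>" "\<epsilon> \<le> 1" "Q \<in> space (prob_algebra borel)"
  shows "prob_space (two_groups \<theta> \<sigma> \<epsilon> Q)"
proof -
  have Q: "prob_space Q" "sets Q = sets borel"
    using assms(4) by (auto simp: space_prob_algebra)
  interpret Q: prob_space Q by (rule Q)
  interpret G: prob_space "gauss 0 \<sigma>" using assms(1) by (rule prob_space_gauss)
  interpret P: pair_prob_space Q "gauss 0 \<sigma>" ..
  have "(\<lambda>(x, y). x + y) \<in> borel_measurable (Q \<Otimes>\<^sub>M gauss 0 \<sigma>)"
    using Q(2) by (auto cong: measurable_cong_sets sets_pair_measure_cong)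
  then have "prob_space (convolution Q (gauss 0 \<sigma>))"
    unfolding convolution_def by (rule P.prob_space_distr)
  then show ?thesis
    unfolding two_groups_def using assms
    by (intro prob_space_mixture prob_space_gauss) auto
qed

lemma prob_space_two_groups_sample:
  assumes "0 < \<sigma>" "0 \<le> \<epsilon>" "\<epsilon> \<le> 1" "Q \<in> space (prob_algebra borel)"
  shows "prob_space (two_groups_sample n \<theta> \<sigma> \<epsilon> Q)"
  unfolding two_groups_sample_def
  by (intro prob_space_PiM prob_space_two_groups assms)

lemma sets_two_groups_sample [simp, measurable_cong]:
  "sets (two_groups_sample n \<theta> \<sigma> \<epsilon> Q) = sets (\<Pi>\<^sub>M i\<in>{..<n}. borel)"
  unfolding two_groups_sample_def by (rule sets_PiM_cong) auto

end

theory Submission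
  imports Defs "HOL-Computational_Algebra.Fundamental_Theorem_Algebra"
begin

text \<open>
  If \<open>\<sigma>\<close> is unknown, a procedure cannot tell genuine noise from noise that the contamination
  imitates. Pure data \<open>N(0, \<sigma>\<^sup>2)\<close> can be written as \<open>N(0, s\<^sup>2)\<close> convolved with
  \<open>N(0, \<rho> s\<^sup>2)\<close>, where \<open>\<sigma>\<^sup>2 = (1 + \<rho>) s\<^sup>2\<close>. Replace the second factor by a discrete
  law that has the same moments up to order \<open>2 m + 1\<close> and an atom of mass at least \<open>1 - \<epsilon>max\<close> at a point
  \<open>s \<sqrt>\<rho> x \<noteq> 0\<close>. The result is a two-groups model with noise level \<open>s\<close>, centre \<open>s \<sqrt>\<rho> x\<close>
  and contamination \<open>\<epsilon>max\<close>, and it is hard to distinguish from the pure data.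

  Such a law exists if the atom is not too heavy. By convex separation
  (\<open>gauss_moments_with_atom\<close>) it suffices that \<open>w p(x) < E p(Z)\<close> for the mass \<open>w\<close> of the atom and
  all nonzero nonnegative polynomials \<open>p\<close> of degree at most \<open>2 m + 1\<close>. As \<open>p\<close> is a sum of two squares,
  this holds if \<open>w\<close> is less than the reciprocal of the Christoffel-Darboux kernel of the Hermite
  polynomials at \<open>x\<close>. At \<open>x = 0\<close> the bound is \<open>2/3\<close> for \<open>m = 3\<close> and \<open>8/15\<close> for \<open>m = 5\<close>,
  so that \<open>w = 1 - \<epsilon>max\<close> is allowed if \<open>\<epsilon>max\<close> exceeds \<open>1/3\<close> or \<open>7/15\<close>, respectively; by continuity the
  same is true for some \<open>x > 0\<close>.

  The chi-square divergence between the two models is at most twice a power series in \<open>\<rho>\<close> whose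
  coefficients are the squared moment differences (\<open>sums_mixture_gap\<close>, \<open>chi_square_le_mixture_gap\<close>).
  Its first \<open>k = 2 m + 2\<close> coefficients vanish, so the divergence is of order \<open>\<rho>\<^sup>k\<close>, and samples of size \<open>n\<close>
  stay indistinguishable if \<open>n \<rho>\<^sup>k\<close> is small (\<open>prob_PiM_density_le\<close>). The
  interval then has to cover, on pure data, the true centre \<open>0\<close> and the alternative centre
  \<open>s \<sqrt>\<rho> x\<close>, which is of order \<open>\<sigma>\<close> times \<open>n\<close> to the power \<open>-1/(2 k) = -1/(4 m + 4)\<close>
  (\<open>confusable_alternatives_rate\<close>). Since \<open>\<delta> < 1/4\<close>, an error \<open>\<delta>\<close> for each of the two coverages
  and the length bound plus \<open>1/4\<close> for the change of the model is less than one, and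
  the length bound must be at least the distance of the centres. Pure data are compatible with every \<open>\<epsilon>\<close>,
  because contamination may sit at the centre itself.
\<close>

section \<open>Nonnegative real polynomials\<close>

text \<open>Induction on the degree, splitting off a quadratic factor that is itself a sum of two squares:
  a real root of a nonnegative polynomial is a double root, and a non-real root \<open>u + i v\<close> gives
  the factor \<open>(X - u)\<^sup>2 + v\<^sup>2\<close>. Sums of two squares are closed under products.\<close>

lemma nonneg_poly_sum_two_squares:
  fixes p :: "real poly"
  assumes "\<And>x. 0 \<le> poly p x"
  shows "\<exists>a b. p = a\<^sup>2 + b\<^sup>2 \<and> 2 * degree a \<le> degree p \<and> 2 * degree b \<le> degree p"
  using assms
proof (induction "degree p" arbitrary: p rule: less_induct)
  case less
  show ?case
  proof (cases "degree p = 0")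
    case True
    then obtain c where c: "p = [:c:]" by (rule degree_eq_zeroE)
    with less.prems[of 0] have "p = [:sqrt c:]\<^sup>2 + 0\<^sup>2" by (simp add: power2_eq_square)
    then show ?thesis using True by (intro exI[of _ "[:sqrt c:]"] exI[of _ 0]) auto
  next
    case deg: False
    then have p0: "p \<noteq> 0" by auto
    show ?thesis
    proof (cases "\<exists>r. poly p r = 0")
      case True
      then obtain r where r: "poly p r = 0" by auto
      then obtain q1 where q1: "p = [:- r, 1:] * q1" by (auto simp: poly_eq_0_iff_dvd)
      \<comment> \<open>The root is a minimum of the polynomial, so the derivative vanishes there as well.\<close>
      have "poly (pderiv p) r = 0"
      proof (rule DERIV_local_min[OF poly_DERIV])
        show "\<forall>y. \<bar>r - y\<bar> < 1 \<longrightarrow> poly p r \<le> poly p y" using less.prems r by simp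
      qed simp
      then have "poly q1 r = 0" unfolding q1 pderiv_mult by (simp add: pderiv_pCons)
      then have "[:- r, 1:] dvd q1" by (simp add: poly_eq_0_iff_dvd)
      then have "[:- r, 1:] ^ 2 dvd p" unfolding q1 power2_eq_square by (rule mult_dvd_mono[OF dvd_refl])
      then obtain q where q: "p = [:- r, 1:] ^ 2 * q" by (elim dvdE)
      with p0 have q0: "q \<noteq> 0" by auto
      have dq: "degree p = 2 + degree q"
        unfolding q using q0 by (subst degree_mult_eq) (auto simp: degree_power_eq)
      have off: "0 \<le> poly q x" if "x \<noteq> r" for x
        using less.prems[of x] that unfolding q by (auto simp: zero_le_mult_iff)
      have "0 \<le> poly q x" for x
      proof (cases "x = r")
        case True
        show ?thesis unfolding True
        proof (rule tendsto_lowerbound)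
          show "(poly q \<longlongrightarrow> poly q r) (at r)" using poly_isCont[of r q] by (simp add: isCont_def)
          show "\<forall>\<^sub>F x in at r. 0 \<le> poly q x" using off by (auto simp: eventually_at_filter)
        qed simp
      qed (use off in auto)
      from less.hyps[OF _ this] dq obtain a b where
        ab: "q = a\<^sup>2 + b\<^sup>2" "2 * degree a \<le> degree q" "2 * degree b \<le> degree q" by auto
      have "p = ([:- r, 1:] * a)\<^sup>2 + ([:- r, 1:] * b)\<^sup>2"
        unfolding q ab(1) by (simp only: power_mult_distrib distrib_left)
      moreover have "2 * degree ([:- r, 1:] * a) \<le> degree p" "2 * degree ([:- r, 1:] * b) \<le> degree p"
        using degree_mult_le[of "[:- r, 1:]" a] degree_mult_le[of "[:- r, 1:]" b] ab dq by auto
      ultimately show ?thesis by blast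
    next
      case noroot: False
      \<comment> \<open>Evaluation of a real polynomial at a complex point, as a ring homomorphism.\<close>
      define E where "E q z = poly (map_poly complex_of_real q) z" for q z
      have map_mult: "map_poly complex_of_real (f * g) = map_poly of_real f * map_poly of_real g" for f g
        by (intro poly_eqI) (simp add: coeff_map_poly coeff_mult)
      have map_add: "map_poly complex_of_real (f + g) = map_poly of_real f + map_poly of_real g" for f g
        by (intro poly_eqI) (simp add: coeff_map_poly)
      have E_mult: "E (f * g) z = E f z * E g z" and E_add: "E (f + g) z = E f z + E g z" for f g z
        unfolding E_def by (simp_all add: map_mult map_add)
      have E_of_real: "E q (complex_of_real x) = complex_of_real (poly q x)" for q x
        unfolding E_def by (simp add: poly_altdef degree_map_poly coeff_map_poly)
      have "degree (map_poly complex_of_real p) \<noteq> 0" using deg by (simp add: degree_map_poly)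
      then have "\<not> constant (poly (map_poly complex_of_real p))" by (simp add: constant_degree)
      then obtain z where z: "E p z = 0" using fundamental_theorem_of_algebra unfolding E_def by blast
      define u v where "u = Re z" and "v = Im z"
      have zuv: "z = Complex u v" by (simp add: u_def v_def)
      have v0: "v \<noteq> 0"
      proof
        assume "v = 0"
        then have "z = complex_of_real u" by (simp add: complex_eq_iff u_def v_def)
        with z E_of_real[of p u] have "poly p u = 0" by simp
        with noroot show False by auto
      qed
      define d :: "real poly" where "d = [:u\<^sup>2 + v\<^sup>2, - 2 * u, 1:]"
      have degd: "degree d = 2" and d0: "d \<noteq> 0" by (auto simp: d_def)
      have Ed: "E d z = 0"
        unfolding E_def d_def zuv
        by (simp add: map_poly_pCons complex_eq_iff power2_eq_square algebra_simps)
      define q where "q = p div d"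
      have "degree (p mod d) < 2"
        using degree_mod_less[OF d0, of p] degd by auto
      then have "degree (p mod d) \<le> 1" by simp
      then have "p mod d = [:coeff (p mod d) 0, coeff (p mod d) 1:]"
        by (intro poly_eqI) (auto simp: coeff_pCons coeff_eq_0 split: nat.splits)
      then obtain m0 m1 where m: "p mod d = [:m0, m1:]" by blast
      \<comment> \<open>The remainder modulo the quadratic factor is linear and real, and vanishes at a non-real point.\<close>
      have p_eq: "p = d * q + [:m0, m1:]" unfolding q_def m[symmetric] by simp
      have "E [:m0, m1:] z = 0" using z unfolding p_eq by (simp add: E_add E_mult Ed)
      then have "m0 + u * m1 = 0" "v * m1 = 0"
        unfolding E_def zuv by (simp_all add: map_poly_pCons complex_eq_iff)
      then have "m0 = 0" "m1 = 0" using v0 by auto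
      then have p_eq': "p = d * q" using p_eq by simp
      with p0 have q0: "q \<noteq> 0" by auto
      have dq: "degree p = 2 + degree q"
        unfolding p_eq' using q0 d0 by (simp add: degree_mult_eq degd)
      have poly_d: "poly d x = (x - u)\<^sup>2 + v\<^sup>2" for x
        by (simp add: d_def power2_eq_square algebra_simps)
      have "0 \<le> poly q x" for x
      proof -
        have "0 < poly d x" unfolding poly_d using v0 by (simp add: add_nonneg_pos)
        then show ?thesis using less.prems[of x] unfolding p_eq' by (simp add: zero_le_mult_iff)
      qed
      from less.hyps[OF _ this] dq obtain a b where
        ab: "q = a\<^sup>2 + b\<^sup>2" "2 * degree a \<le> degree q" "2 * degree b \<le> degree q" by auto
      define l where "l = [:- u, 1:]"
      \<comment> \<open>Brahmagupta's identity for the product of two sums of two squares.\<close>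
      have "d = l\<^sup>2 + [:v:]\<^sup>2" by (simp add: d_def l_def power2_eq_square)
      then have "p = (l * a - [:v:] * b)\<^sup>2 + (l * b + [:v:] * a)\<^sup>2"
        unfolding p_eq' ab(1) by algebra
      moreover have "2 * degree (l * a - [:v:] * b) \<le> degree p" "2 * degree (l * b + [:v:] * a) \<le> degree p"
      proof -
        have dl: "degree l = 1" by (simp add: l_def)
        have "degree (l * f) \<le> Suc (degree f)" "degree ([:v:] * f) \<le> Suc (degree f)" for f
          using degree_mult_le[of l f] degree_mult_le[of "[:v:]" f] dl by auto
        then have *: "degree (l * f - [:v:] * g) \<le> Suc (max (degree f) (degree g))"
          "degree (l * f + [:v:] * g) \<le> Suc (max (degree f) (degree g))" for f g
          by (meson degree_diff_le degree_add_le le_trans max.cobounded1 max.cobounded2 Suc_le_mono)+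
        show "2 * degree (l * a - [:v:] * b) \<le> degree p" "2 * degree (l * b + [:v:] * a) \<le> degree p"
          using *(1)[of a b] *(2)[of b a] ab dq by (auto simp: max_def split: if_splits)
      qed
      ultimately show ?thesis by blast
    qed
  qed
qed

section \<open>Gaussian moments and Hermite polynomials\<close>

definition gauss_moment :: "nat \<Rightarrow> real" where
  "gauss_moment j = (if even j then fact j / (2 ^ (j div 2) * fact (j div 2)) else 0)"

text \<open>The expectation \<open>E p(Z)\<close> for a standard Gaussian \<open>Z\<close>, written through the moments so that it
  is visibly a linear functional of the coefficients.\<close>

definition gauss_mean :: "real poly \<Rightarrow> real" where
  "gauss_mean p = (\<Sum>j\<le>degree p. coeff p j * gauss_moment j)"

lemma gauss_mean_eq:
  assumes "degree p \<le> N"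
  shows "gauss_mean p = (\<Sum>j\<le>N. coeff p j * gauss_moment j)"
  unfolding gauss_mean_def using assms
  by (intro sum.mono_neutral_left) (auto simp: coeff_eq_0)

lemma poly_eq_sum_coeff:
  fixes p :: "real poly"
  assumes "degree p \<le> N"
  shows "poly p x = (\<Sum>j\<le>N. coeff p j * x ^ j)"
  unfolding poly_altdef using assms
  by (intro sum.mono_neutral_left) (auto simp: coeff_eq_0)

lemma gauss_mean_add: "gauss_mean (p + q) = gauss_mean p + gauss_mean q"
proof -
  define N where "N = max (degree p) (degree q)"
  have "degree (p + q) \<le> N" "degree p \<le> N" "degree q \<le> N"
    by (simp_all add: N_def degree_add_le_max)
  then show ?thesis by (simp add: gauss_mean_eq[of _ N] sum.distrib distrib_right)
qed

lemma gauss_moment_numerals: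
  "gauss_moment 0 = 1" "gauss_moment (Suc 0) = 0" "gauss_moment 2 = 1" "gauss_moment 3 = 0" "gauss_moment 4 = 3"
  "gauss_moment 5 = 0" "gauss_moment 6 = 15" "gauss_moment 7 = 0" "gauss_moment 8 = 105"
  "gauss_moment 9 = 0" "gauss_moment 10 = 945"
  by (simp_all add: gauss_moment_def fact_numeral)

text \<open>The probabilists' Hermite polynomials: orthogonal for the standard Gaussian, the \<open>i\<close>-th one
  with squared norm \<open>i!\<close>.\<close>

fun hermite :: "nat \<Rightarrow> real \<Rightarrow> real" where
  "hermite 0 x = 1"
| "hermite (Suc 0) x = x"
| "hermite (Suc (Suc n)) x = x * hermite (Suc n) x - real (Suc n) * hermite n x"

text \<open>Expansion in Hermite polynomials together with Parseval's identity. The two rates in the theorem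
  need polynomials of degree three and five, so the expansion is written out up to degree five.\<close>

lemma gauss_mean_square_deg_5:
  assumes "degree a \<le> 5"
  shows "\<exists>c :: nat \<Rightarrow> real. (\<forall>i. degree a < i \<longrightarrow> c i = 0) \<and>
    (\<forall>x. poly a x = (\<Sum>i\<le>5. c i * hermite i x)) \<and>
    gauss_mean (a\<^sup>2) = (\<Sum>i\<le>5. fact i * (c i)\<^sup>2)"
proof -
  define A where "A = coeff a"
  have A0: "A i = 0" if "degree a < i" for i using that by (simp add: A_def coeff_eq_0)
  \<comment> \<open>From \<open>x\<^sup>2 = H\<^sub>2 + 1\<close>, \<open>x\<^sup>3 = H\<^sub>3 + 3 H\<^sub>1\<close>, \<open>x\<^sup>4 = H\<^sub>4 + 6 H\<^sub>2 + 3\<close>, \<open>x\<^sup>5 = H\<^sub>5 + 10 H\<^sub>3 + 15 H\<^sub>1\<close>.\<close>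
  define c where "c = (\<lambda>i::nat. if i = 0 then A 0 + A 2 + 3 * A 4 else if i = 1 then A 1 + 3 * A 3 + 15 * A 5
    else if i = 2 then A 2 + 6 * A 4 else if i = 3 then A 3 + 10 * A 5 else if i = 4 then A 4
    else if i = 5 then A 5 else 0)"
  have s5: "{..5::nat} = {0,1,2,3,4,5}" and s10: "{..10::nat} = {0,1,2,3,4,5,6,7,8,9,10}"
    by (simp_all only: set_eq_iff atMost_iff insert_iff empty_iff) presburger+
  have "c i = 0" if "degree a < i" for i using that unfolding c_def by (auto simp: A0)
  moreover have "poly a x = (\<Sum>i\<le>5. c i * hermite i x)" for x
    unfolding poly_eq_sum_coeff[OF assms] A_def[symmetric] s5 c_def
    by (simp add: eval_nat_numeral algebra_simps)
  moreover have "gauss_mean (a\<^sup>2) = (\<Sum>i\<le>5. fact i * (c i)\<^sup>2)"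
  proof -
    have d: "degree (a\<^sup>2) \<le> 10" using assms degree_power_le[of a 2] by simp
    have z: "A 6 = 0" "A 7 = 0" "A 8 = 0" "A 9 = 0" "A 10 = 0" using assms by (auto intro!: A0)
    have co: "coeff (a\<^sup>2) j = (\<Sum>i\<le>j. A i * A (j - i))" for j
      by (simp add: A_def power2_eq_square coeff_mult)
    have s: "{..0::nat} = {0}" "{..2::nat} = {0,1,2}" "{..4::nat} = {0,1,2,3,4}"  "{..6::nat} = {0,1,2,3,4,5,6}"
     "{..8::nat} = {0,1,2,3,4,5,6,7,8}"
      by (simp_all only: set_eq_iff atMost_iff insert_iff empty_iff) presburger+
    have "gauss_mean (a\<^sup>2) = (\<Sum>i\<le>0. A i * A (0 - i)) + (\<Sum>i\<le>2. A i * A (2 - i)) + 3 * (\<Sum>i\<le>4. A i * A (4 - i))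
       + 15 * (\<Sum>i\<le>6. A i * A (6 - i)) + 105 * (\<Sum>i\<le>8. A i * A (8 - i)) + 945 * (\<Sum>i\<le>10. A i * A (10 - i))"
      unfolding gauss_mean_eq[OF d] by (simp add: s10 co gauss_moment_numerals)
    also have "\<dots> = (\<Sum>i\<le>5. fact i * (c i)\<^sup>2)"
      unfolding s s10 s5 c_def by (simp add: z fact_numeral power2_eq_square algebra_simps)
    finally show ?thesis .
  qed
  ultimately show ?thesis by blast
qed

text \<open>The diagonal of the Christoffel-Darboux kernel: the squared norm of evaluation at \<open>x\<close> on the
  polynomials of degree at most \<open>m\<close> with the Gaussian inner product. Its reciprocal bounds
  the mass at \<open>x\<close> of every distribution that has the Gaussian moments up to order \<open>2 m\<close>.\<close>

definition hermite_kernel :: "nat \<Rightarrow> real \<Rightarrow> real" where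
  "hermite_kernel m x = (\<Sum>i\<le>m. (hermite i x)\<^sup>2 / fact i)"

text \<open>The Cauchy-Schwarz inequality in Hermite coordinates.\<close>

lemma poly_square_le_hermite_kernel:
  assumes "degree a \<le> m" "m \<le> 5"
  shows "(poly a x)\<^sup>2 \<le> hermite_kernel m x * gauss_mean (a\<^sup>2)"
    and "a \<noteq> 0 \<Longrightarrow> 0 < gauss_mean (a\<^sup>2)"
proof -
  obtain c where c0: "\<And>i. degree a < i \<Longrightarrow> c i = 0"
    and cx: "\<And>x. poly a x = (\<Sum>i\<le>5. c i * hermite i x)"
    and cm: "gauss_mean (a\<^sup>2) = (\<Sum>i\<le>5. fact i * (c i)\<^sup>2)"
    using gauss_mean_square_deg_5[of a] assms by auto
  have "poly a x = (\<Sum>i\<le>m. c i * hermite i x)"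
    unfolding cx using assms by (intro sum.mono_neutral_right) (auto simp: c0)
  also have "\<dots> = (\<Sum>i\<le>m. (hermite i x / sqrt (fact i)) * (sqrt (fact i) * c i))"
    by (intro sum.cong) auto
  finally have "(poly a x)\<^sup>2 \<le> (\<Sum>i\<le>m. (hermite i x / sqrt (fact i))\<^sup>2) * (\<Sum>i\<le>m. (sqrt (fact i) * c i)\<^sup>2)"
    by (simp only: Cauchy_Schwarz_ineq_sum)
  also have "(\<Sum>i\<le>m. (sqrt (fact i) * c i)\<^sup>2) = gauss_mean (a\<^sup>2)"
    unfolding cm power_mult_distrib using assms by (intro sum.mono_neutral_cong_left) (auto simp: c0)
  also have "(\<Sum>i\<le>m. (hermite i x / sqrt (fact i))\<^sup>2) = hermite_kernel m x"
    by (simp add: hermite_kernel_def power_divide)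
  finally show "(poly a x)\<^sup>2 \<le> hermite_kernel m x * gauss_mean (a\<^sup>2)" .
  show "0 < gauss_mean (a\<^sup>2)" if "a \<noteq> 0"
  proof (rule ccontr)
    assume "\<not> ?thesis"
    moreover have "0 \<le> gauss_mean (a\<^sup>2)" unfolding cm by (intro sum_nonneg) auto
    ultimately have "(\<Sum>i\<le>5. fact i * (c i)\<^sup>2) = 0" unfolding cm by simp
    then have "\<forall>i\<in>{..5}. fact i * (c i)\<^sup>2 = 0" by (subst (asm) sum_nonneg_eq_0_iff) auto
    then have "c i = 0" if "i \<le> 5" for i using that by auto
    then have "poly a = poly 0" by (intro ext) (simp add: cx)
    then show False using that by (simp add: poly_eq_poly_eq_iff)
  qed
qed

section \<open>Moment-matched laws with a heavy atom\<close>

lemma gauss_mean_const: "gauss_mean [:c:] = c"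
  by (simp add: gauss_mean_def gauss_moment_def)

lemma gauss_mean_monom: "gauss_mean (monom c n) = c * gauss_moment n"
proof -
  have "gauss_mean (monom c n) = (\<Sum>j\<le>n. if n = j then c * gauss_moment j else 0)"
    unfolding gauss_mean_eq[OF degree_monom_le] by (intro sum.cong) auto
  then show ?thesis by simp
qed

lemma gauss_mean_sum: "finite I \<Longrightarrow> gauss_mean (\<Sum>i\<in>I. f i) = (\<Sum>i\<in>I. gauss_mean (f i))"
  by (induction I rule: finite_induct) (use gauss_mean_const[of 0] in \<open>simp_all add: gauss_mean_add\<close>)

text \<open>A nonnegative polynomial of degree at most \<open>2 m + 1\<close> is a sum of two squares of polynomials of
  degree at most \<open>m\<close>, and the kernel bounds the value at \<open>x\<close> of each square. This is the dual form of
  the statement that an atom of mass \<open>w\<close> fits under the Gaussian moments.\<close>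

lemma nonneg_poly_gauss_mean_gt:
  assumes "\<And>y. 0 \<le> poly p y" "p \<noteq> 0" "degree p \<le> 2 * m + 1" "m \<le> 5"
    and "0 \<le> w" "w * hermite_kernel m x < 1"
  shows "w * poly p x < gauss_mean p"
proof -
  obtain a b where p: "p = a\<^sup>2 + b\<^sup>2" and deg: "degree a \<le> m" "degree b \<le> m"
    using nonneg_poly_sum_two_squares[OF assms(1)] assms(3) by fastforce
  have strict: "w * (poly q x)\<^sup>2 < gauss_mean (q\<^sup>2)" if "degree q \<le> m" "q \<noteq> 0" for q
  proof -
    have "w * (poly q x)\<^sup>2 \<le> w * hermite_kernel m x * gauss_mean (q\<^sup>2)"
      using poly_square_le_hermite_kernel(1)[OF that(1) assms(4)] assms(5)
      by (simp add: mult.assoc mult_left_mono)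
    also have "\<dots> < 1 * gauss_mean (q\<^sup>2)"
      using poly_square_le_hermite_kernel(2)[OF that(1) assms(4) that(2)] assms(6)
      by (intro mult_strict_right_mono)
    finally show ?thesis by simp
  qed
  have weak: "w * (poly q x)\<^sup>2 \<le> gauss_mean (q\<^sup>2)" if "degree q \<le> m" for q
    using strict[OF that] gauss_mean_const[of 0] by (cases "q = 0") auto
  have "a \<noteq> 0 \<or> b \<noteq> 0" using p assms(2) by auto
  then show ?thesis
    unfolding p using strict[OF deg(1)] strict[OF deg(2)] weak[OF deg(1)] weak[OF deg(2)]
    by (auto simp: gauss_mean_add distrib_left)
qed

text \<open>There is a finitely supported distribution that has an atom of mass at least \<open>w\<close> at \<open>x\<close> and the
  Gaussian moments up to order \<open>2 m + 1\<close>. Otherwise the moment vector prescribed for the rest of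
  the mass lies outside the convex hull of the moment curve; the normal vector of a separating hyperplane is
  the coefficient vector of a nonnegative polynomial that contradicts the preceding lemma.
  The index type only serves to make the space of vectors of \<open>2 m + 1\<close> moments a Euclidean space.
  The zeroth moment is left out because it is constant on the curve, and a hyperplane that
  sees only that coordinate would say nothing.\<close>

lemma gauss_moments_with_atom:
  fixes x w :: real
  assumes card: "CARD('n::finite) = 2 * m + 1" and m: "m \<le> 5"
    and w: "0 \<le> w" "w < 1" "w * hermite_kernel m x < 1"
  shows "\<exists>S p. finite S \<and> (\<forall>u\<in>S. 0 \<le> p u) \<and> sum p S = 1 \<and>
    (\<forall>j\<le>2 * m + 1. w * x ^ j + (1 - w) * (\<Sum>u\<in>S. p u * u ^ j) = gauss_moment j)"
proof -
  obtain h :: "'n \<Rightarrow> nat" where h: "bij_betw h UNIV {0..<2 * m + 1}"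
    using ex_bij_betw_finite_nat[of "UNIV :: 'n set"] card by auto
  have h_less: "h i < 2 * m + 1" for i using h by (auto simp: bij_betw_def)
  have inj: "h i = h j \<longleftrightarrow> i = j" for i j using h by (auto simp: bij_betw_def inj_on_def)
  define f :: "real \<Rightarrow> real ^ 'n" where "f y = (\<chi> i. y ^ Suc (h i))" for y
  define z :: "real ^ 'n" where "z = (\<chi> i. (gauss_moment (Suc (h i)) - w * x ^ Suc (h i)) / (1 - w))"
  have "z \<in> convex hull (range f)"
  proof (rule ccontr)
    assume "z \<notin> convex hull (range f)"
    then obtain a b where a: "a \<noteq> 0" and az: "a \<bullet> z \<le> b" and af: "\<And>v. v \<in> convex hull (range f) \<Longrightarrow> a \<bullet> v \<ge> b"
      using separating_hyperplane_sets[of "{z}" "convex hull (range f)"] by auto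
    define P where "P = (\<Sum>i\<in>UNIV. monom (a $ i) (Suc (h i))) + [:- (a \<bullet> z):]"
    have polyP: "poly P y = a \<bullet> f y - a \<bullet> z" for y
      by (simp add: P_def poly_sum poly_monom inner_vec_def f_def)
    have "0 \<le> poly P y" for y
      using af[of "f y"] az by (simp add: polyP hull_inc)
    moreover have "P \<noteq> 0"
    proof -
      obtain i where i: "a $ i \<noteq> 0" using a by (auto simp: vec_eq_iff)
      have "coeff P (Suc (h i)) = (\<Sum>j\<in>UNIV. if j = i then a $ j else 0)"
        by (simp add: P_def coeff_sum inj)
      then have "coeff P (Suc (h i)) = a $ i" by simp
      with i show ?thesis by auto
    qed
    moreover have "degree P \<le> 2 * m + 1"
    proof -
      have "degree (monom (a $ i) (Suc (h i))) \<le> 2 * m + 1" for i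
        using h_less[of i] degree_monom_le[of "a $ i" "Suc (h i)"] by linarith
      then show ?thesis unfolding P_def by (intro degree_add_le degree_sum_le) auto
    qed
    \<comment> \<open>The functional \<open>p \<mapsto> (E p(Z) - w p(x)) / (1 - w)\<close> evaluates a polynomial by the moments in \<open>z\<close>.\<close>
    moreover have "gauss_mean P = w * poly P x"
    proof -
      have "gauss_mean P = (\<Sum>i\<in>UNIV. a $ i * gauss_moment (Suc (h i))) - a \<bullet> z"
        by (simp add: P_def gauss_mean_add gauss_mean_sum gauss_mean_monom gauss_mean_const)
      also have "(\<Sum>i\<in>UNIV. a $ i * gauss_moment (Suc (h i))) = (\<Sum>i\<in>UNIV. a $ i * ((1 - w) * z $ i + w * f x $ i))"
        using w by (simp add: z_def f_def)
      also have "\<dots> = (1 - w) * (a \<bullet> z) + w * (a \<bullet> f x)"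
        unfolding inner_vec_def sum_distrib_left sum.distrib[symmetric]
        by (intro sum.cong refl) (simp add: algebra_simps)
      finally show ?thesis by (simp add: polyP algebra_simps)
    qed
    ultimately show False
      using nonneg_poly_gauss_mean_gt[of P m w x] m w by auto
  qed
  then obtain T q where T: "finite T" "T \<subseteq> range f" "\<And>v. v \<in> T \<Longrightarrow> 0 \<le> q v" "sum q T = 1"
    and zT: "(\<Sum>v\<in>T. q v *\<^sub>R v) = z"
    unfolding convex_hull_explicit by auto
  define g where "g = inv_into UNIV f"
  have fg: "f (g v) = v" if "v \<in> T" for v using that T(2) unfolding g_def by (auto intro: f_inv_into_f)
  have inj_g: "inj_on g T" by (rule inj_on_inverseI[of _ f]) (rule fg)
  define S where "S = g ` T"
  define p where "p = (\<lambda>u. q (f u))"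
  have sumS: "(\<Sum>u\<in>S. p u * u ^ j) = (\<Sum>v\<in>T. q v * g v ^ j)" for j
    unfolding S_def p_def using inj_g by (simp add: sum.reindex fg)
  have "w * x ^ j + (1 - w) * (\<Sum>u\<in>S. p u * u ^ j) = gauss_moment j" if j: "j \<le> 2 * m + 1" for j
  proof (cases j)
    case 0
    then show ?thesis unfolding sumS using T(4) by (simp add: gauss_moment_def)
  next
    case (Suc k)
    then have "k \<in> {0..<2 * m + 1}" using j by simp
    then obtain i where i: "k = h i" using bij_betw_imp_surj_on[OF h] by blast
    have "(\<Sum>u\<in>S. p u * u ^ j) = (\<Sum>v\<in>T. q v * f (g v) $ i)"
      unfolding sumS Suc i f_def by simp
    also have "\<dots> = (\<Sum>v\<in>T. q v *\<^sub>R v) $ i" by (simp add: fg)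
    also have "\<dots> = (gauss_moment j - w * x ^ j) / (1 - w)" unfolding zT by (simp add: z_def Suc i)
    finally show ?thesis using w by simp
  qed
  moreover have "finite S" "\<forall>u\<in>S. 0 \<le> p u" "sum p S = 1"
    using T sumS[of 0] by (auto simp: S_def p_def fg)
  ultimately show ?thesis by blast
qed

lemma hermite_kernel_at_0: "hermite_kernel 3 0 = 3 / 2" "hermite_kernel 5 0 = 15 / 8"
  by (simp_all add: hermite_kernel_def eval_nat_numeral)

lemma continuous_hermite_kernel: "isCont (hermite_kernel m) x"
proof -
  have "continuous_on UNIV (hermite i)" for i
  proof (induction i rule: induct_nat_012)
    case (ge2 n)
    then show ?case by (auto intro!: continuous_intros)
  qed auto
  then have "isCont (hermite i) x" for i by (simp add: continuous_on_eq_continuous_at)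
  then show ?thesis unfolding hermite_kernel_def by (intro continuous_intros) auto
qed

text \<open>At \<open>0\<close> an atom would not shift the centre of the data, so the strict inequality there is moved to a
  nearby positive point.\<close>

lemma nonzero_node_exists:
  assumes "w * hermite_kernel m 0 < 1"
  shows "\<exists>x>0. w * hermite_kernel m x < 1"
proof -
  have "((\<lambda>x. w * hermite_kernel m x) \<longlongrightarrow> w * hermite_kernel m 0) (at_right 0)"
    using continuous_hermite_kernel[of 0 m] by (intro tendsto_intros) (auto simp: isCont_def intro: tendsto_within_subset)
  then have "eventually (\<lambda>x. w * hermite_kernel m x < 1) (at_right 0)"
    using assms by (rule order_tendstoD)
  then have "eventually (\<lambda>x. w * hermite_kernel m x < 1 \<and> x > 0) (at_right 0)"
    by (intro eventually_conj eventually_at_right_less)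
  then show ?thesis using eventually_happens[of _ "at_right (0::real)"] by fastforce
qed

section \<open>The divergence as a power series\<close>

lemma gauss_moment_even: "gauss_moment (2 * i) = fact (2 * i) / (2 ^ i * fact i)"
  by (simp add: gauss_moment_def)

lemma sums_even_iff:
  fixes f :: "nat \<Rightarrow> real"
  assumes "\<And>j. odd j \<Longrightarrow> f j = 0"
  shows "(\<lambda>i. f (2 * i)) sums s \<longleftrightarrow> f sums s"
proof (rule sums_mono_reindex)
  show "strict_mono (\<lambda>i::nat. 2 * i)" by (simp add: strict_mono_def)
  show "f n = 0" if "n \<notin> range (\<lambda>i. 2 * i)" for n
    using that assms[of n] by (auto elim: evenE)
qed

text \<open>The series of the Gaussian moment generating function.\<close>

lemma sums_gauss_moment_exp:
  "(\<lambda>j. t ^ j * gauss_moment j / fact j) sums exp (t\<^sup>2 / 2)"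
proof (subst sums_even_iff[symmetric])
  have "t ^ (2 * i) * gauss_moment (2 * i) / fact (2 * i) = (t\<^sup>2 / 2) ^ i /\<^sub>R fact i" for i
    unfolding gauss_moment_even by (simp add: power_mult power_divide divide_simps)
  then show "(\<lambda>i. t ^ (2 * i) * gauss_moment (2 * i) / fact (2 * i)) sums exp (t\<^sup>2 / 2)"
    using exp_converges[of "t\<^sup>2 / 2"] by simp
qed (simp add: gauss_moment_def)

lemma gbinomial_minus_half:
  "(- 1 / 2 :: real) gchoose k = (- 1) ^ k * fact (2 * k) / (4 ^ k * (fact k)\<^sup>2)"
proof -
  have "(\<Prod>i<k. - 1 / 2 - real i) = (- 1) ^ k * fact (2 * k) / (4 ^ k * fact k)"
  proof (induction k)
    case (Suc k)
    have "(fact (2 * Suc k) :: real) = 2 * (real k + 1) * (2 * real k + 1) * fact (2 * k)"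
      by (simp add: algebra_simps)
    then show ?case unfolding prod.lessThan_Suc Suc by (simp add: divide_simps) (simp add: algebra_simps)
  qed simp
  then show ?thesis by (simp add: gbinomial_prod_rev atLeast0LessThan power2_eq_square)
qed

text \<open>The series of \<open>E exp (\<rho> Z Z')\<close> for independent standard Gaussian \<open>Z\<close>, \<open>Z'\<close>. The coefficients are
  the central binomial coefficients, so the sum is a binomial series with exponent \<open>-1/2\<close>.\<close>

lemma sums_gauss_moment_square:
  assumes "\<bar>\<rho>\<bar> < 1"
  shows "(\<lambda>j. \<rho> ^ j * (gauss_moment j)\<^sup>2 / fact j) sums (1 / sqrt (1 - \<rho>\<^sup>2))"
proof (subst sums_even_iff[symmetric])
  have lt: "\<rho>\<^sup>2 < 1" using assms by (simp add: abs_square_less_1)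
  have "\<rho> ^ (2 * i) * (gauss_moment (2 * i))\<^sup>2 / fact (2 * i) = ((- 1 / 2) gchoose i) * (- (\<rho>\<^sup>2)) ^ i" for i
  proof -
    have "((- 1 / 2) gchoose i) * (- (\<rho>\<^sup>2)) ^ i = ((-1) ^ i * (-1) ^ i) * (\<rho>\<^sup>2) ^ i * fact (2 * i) / (4 ^ i * (fact i)\<^sup>2)"
      unfolding gbinomial_minus_half power_minus[of "\<rho>\<^sup>2"] by simp
    also have "(-1) ^ i * (-1) ^ i = (1::real)" by (simp flip: power_mult_distrib)
    also have "(4::real) ^ i = (2 ^ i)\<^sup>2" using power_mult_distrib[of "2::real" 2 i] by (simp add: power2_eq_square)
    also have "1 * (\<rho>\<^sup>2) ^ i * fact (2 * i) / ((2 ^ i)\<^sup>2 * (fact i)\<^sup>2) = \<rho> ^ (2 * i) * (gauss_moment (2 * i))\<^sup>2 / fact (2 * i)"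
      unfolding gauss_moment_even by (simp add: power_mult power_divide power_mult_distrib power2_eq_square[of "fact (2 * i)"])
    finally show ?thesis by simp
  qed
  moreover have "(1 - \<rho>\<^sup>2) powr (- (1 / 2)) = 1 / sqrt (1 - \<rho>\<^sup>2)"
    using lt by (simp add: powr_minus_divide powr_half_sqrt)
  ultimately show "(\<lambda>i. \<rho> ^ (2 * i) * (gauss_moment (2 * i))\<^sup>2 / fact (2 * i)) sums (1 / sqrt (1 - \<rho>\<^sup>2))"
    using gen_binomial_real[of "- (\<rho>\<^sup>2)" "- 1 / 2"] lt by simp
qed (simp add: gauss_moment_def)

text \<open>Let \<open>D\<close> be the signed measure that is the difference of \<open>\<Sum>u\<in>S. p u \<cdot> \<delta>\<^sub>u\<close> and the standard
  Gaussian. For \<open>\<bar>\<rho>\<bar> < 1\<close> this is \<open>\<integral>\<integral> exp (\<rho> u v) D(du) D(dv)\<close> with the Gaussian integrals evaluated.\<close>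

definition mixture_gap :: "real set \<Rightarrow> (real \<Rightarrow> real) \<Rightarrow> real \<Rightarrow> real" where
  "mixture_gap S p \<rho> = (\<Sum>u\<in>S. \<Sum>v\<in>S. p u * p v * exp (\<rho> * u * v))
     - 2 * (\<Sum>u\<in>S. p u * exp ((\<rho> * u)\<^sup>2 / 2)) + 1 / sqrt (1 - \<rho>\<^sup>2)"

text \<open>Expanding the exponential in the double integral turns it into a power series in \<open>\<rho>\<close> whose
  coefficients are squares of moment differences.\<close>

lemma sums_mixture_gap:
  assumes "\<bar>\<rho>\<bar> < 1"
  shows "(\<lambda>j. \<rho> ^ j * ((\<Sum>u\<in>S. p u * u ^ j) - gauss_moment j)\<^sup>2 / fact j) sums mixture_gap S p \<rho>"
proof -
  have "(\<lambda>j. \<Sum>u\<in>S. \<Sum>v\<in>S. p u * p v * ((\<rho> * u * v) ^ j /\<^sub>R fact j))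
      sums (\<Sum>u\<in>S. \<Sum>v\<in>S. p u * p v * exp (\<rho> * u * v))"
    by (intro sums_sum sums_mult exp_converges)
  moreover have "(\<Sum>u\<in>S. \<Sum>v\<in>S. p u * p v * ((\<rho> * u * v) ^ j /\<^sub>R fact j)) = \<rho> ^ j * (\<Sum>u\<in>S. p u * u ^ j)\<^sup>2 / fact j" for j
    by (simp add: power2_eq_square sum_product sum_distrib_left sum_divide_distrib power_mult_distrib
        divide_inverse mult_ac)
  moreover have "(\<lambda>j. 2 * (\<Sum>u\<in>S. p u * ((\<rho> * u) ^ j * gauss_moment j / fact j)))
      sums (2 * (\<Sum>u\<in>S. p u * exp ((\<rho> * u)\<^sup>2 / 2)))"
    by (intro sums_sum sums_mult sums_gauss_moment_exp)
  moreover have "(\<Sum>u\<in>S. p u * ((\<rho> * u) ^ j * gauss_moment j / fact j)) = \<rho> ^ j * (\<Sum>u\<in>S. p u * u ^ j) * gauss_moment j / fact j" for j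
    unfolding sum_distrib_left sum_distrib_right sum_divide_distrib
    by (intro sum.cong refl) (simp add: power_mult_distrib mult_ac)
  ultimately have "(\<lambda>j. \<rho> ^ j * (\<Sum>u\<in>S. p u * u ^ j)\<^sup>2 / fact j
      - 2 * (\<rho> ^ j * (\<Sum>u\<in>S. p u * u ^ j) * gauss_moment j / fact j)
      + \<rho> ^ j * (gauss_moment j)\<^sup>2 / fact j) sums mixture_gap S p \<rho>"
    unfolding mixture_gap_def by (intro sums_add sums_diff sums_gauss_moment_square assms) simp_all
  moreover have "\<rho> ^ j * M\<^sup>2 / fact j - 2 * (\<rho> ^ j * M * g / fact j) + \<rho> ^ j * g\<^sup>2 / fact j
      = \<rho> ^ j * (M - g)\<^sup>2 / fact j" for j and M g :: real
    by (simp add: power2_diff field_simps)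
  ultimately show ?thesis by simp
qed

text \<open>All coefficients of the power series are nonnegative and the first \<open>k\<close> of them vanish, hence its
  value at \<open>\<rho>\<close> is at most \<open>(\<rho> / \<rho>')\<^sup>k\<close> times its value at any larger radius \<open>\<rho>' < 1\<close>, here \<open>1/2\<close>.\<close>

lemma mixture_gap_bounds:
  assumes "\<And>j. j < k \<Longrightarrow> (\<Sum>u\<in>S. p u * u ^ j) = gauss_moment j" and "0 \<le> \<rho>" "\<rho> \<le> 1 / 2"
  shows "0 \<le> mixture_gap S p \<rho>" "mixture_gap S p \<rho> \<le> (2 * \<rho>) ^ k * mixture_gap S p (1 / 2)"
proof -
  let ?d = "\<lambda>j. ((\<Sum>u\<in>S. p u * u ^ j) - gauss_moment j)\<^sup>2 / fact j"
  have s: "(\<lambda>j. \<rho> ^ j * ?d j) sums mixture_gap S p \<rho>"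
    using sums_mixture_gap[of \<rho> p S] assms by simp
  show "0 \<le> mixture_gap S p \<rho>"
    using sums_le[OF _ sums_zero s] assms(2) by simp
  have s': "(\<lambda>j. (2 * \<rho>) ^ k * ((1 / 2) ^ j * ?d j)) sums ((2 * \<rho>) ^ k * mixture_gap S p (1 / 2))"
    using sums_mixture_gap[of "1/2" p S] by (intro sums_mult) simp
  have "\<rho> ^ j * ?d j \<le> (2 * \<rho>) ^ k * ((1 / 2) ^ j * ?d j)" for j
  proof (cases "j < k")
    case False
    have "\<rho> ^ j = (2 * \<rho>) ^ j * (1 / 2) ^ j" by (simp add: power_mult_distrib power_divide)
    also have "\<dots> \<le> (2 * \<rho>) ^ k * (1 / 2) ^ j"
      using assms False by (intro mult_right_mono power_decreasing) auto
    finally have "\<rho> ^ j * ?d j \<le> (2 * \<rho>) ^ k * (1 / 2) ^ j * ?d j" by (intro mult_right_mono) auto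
    then show ?thesis by (simp only: mult.assoc)
  qed (simp add: assms(1))
  then show "mixture_gap S p \<rho> \<le> (2 * \<rho>) ^ k * mixture_gap S p (1 / 2)"
    by (rule sums_le[OF _ s s'])
qed

section \<open>Chi-square divergence of Gaussian mixtures\<close>

text \<open>The three products of Gaussian densities that occur in the square below, by completing the
  square in the exponent. Each is a constant times a Gaussian density, times \<open>N(0, s\<^sup>2)\<close>.\<close>

lemma normal_density_mult_same_scale:
  assumes "0 < s"
  shows "normal_density a s y * normal_density b s y
    = exp (a * b / s\<^sup>2) * normal_density (a + b) s y * normal_density 0 s y"
proof -
  have "exp (- (y - a)\<^sup>2 / (2 * s\<^sup>2)) * exp (- (y - b)\<^sup>2 / (2 * s\<^sup>2))
      = exp (a * b / s\<^sup>2) * exp (- (y - (a + b))\<^sup>2 / (2 * s\<^sup>2)) * exp (- (y - 0)\<^sup>2 / (2 * s\<^sup>2))"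
    unfolding mult_exp_exp using assms
    by (intro arg_cong[where f = exp]) (simp add: field_simps power2_eq_square)
  then show ?thesis unfolding normal_density_def by simp
qed

lemma normal_density_mult_wider_scale:
  assumes "0 < s" "0 \<le> \<rho>"
  shows "normal_density a s y * normal_density 0 (s * sqrt (1 + \<rho>)) y
    = exp (\<rho> * a\<^sup>2 / (2 * s\<^sup>2)) * normal_density (a * (1 + \<rho>)) (s * sqrt (1 + \<rho>)) y * normal_density 0 s y"
proof -
  have sq: "(s * sqrt (1 + \<rho>))\<^sup>2 = s\<^sup>2 * (1 + \<rho>)" using assms by (simp add: power_mult_distrib)
  have "0 < s\<^sup>2" "0 < 1 + \<rho>" using assms by auto
  then have "exp (- (y - a)\<^sup>2 / (2 * s\<^sup>2)) * exp (- (y - 0)\<^sup>2 / (2 * (s\<^sup>2 * (1 + \<rho>))))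
      = exp (\<rho> * a\<^sup>2 / (2 * s\<^sup>2)) * exp (- (y - a * (1 + \<rho>))\<^sup>2 / (2 * (s\<^sup>2 * (1 + \<rho>)))) * exp (- (y - 0)\<^sup>2 / (2 * s\<^sup>2))"
    unfolding mult_exp_exp
    by (intro arg_cong[where f = exp]) (simp add: divide_simps, simp add: algebra_simps power2_eq_square)
  then show ?thesis unfolding normal_density_def sq by simp
qed

lemma normal_density_square_wider_scale:
  assumes "0 < s" "0 \<le> \<rho>" "\<rho> < 1"
  shows "(normal_density 0 (s * sqrt (1 + \<rho>)) y)\<^sup>2
    = 1 / sqrt (1 - \<rho>\<^sup>2) * normal_density 0 (s * sqrt ((1 + \<rho>) / (1 - \<rho>))) y * normal_density 0 s y"
proof -
  have sq: "(s * sqrt (1 + \<rho>))\<^sup>2 = s\<^sup>2 * (1 + \<rho>)"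
    "(s * sqrt ((1 + \<rho>) / (1 - \<rho>)))\<^sup>2 = s\<^sup>2 * ((1 + \<rho>) / (1 - \<rho>))"
    using assms by (simp_all add: power_mult_distrib)
  have pos: "0 < s\<^sup>2" "0 < 1 + \<rho>" "0 < 1 - \<rho>" using assms by auto
  then have e: "exp (- (y - 0)\<^sup>2 / (2 * (s\<^sup>2 * (1 + \<rho>)))) * exp (- (y - 0)\<^sup>2 / (2 * (s\<^sup>2 * (1 + \<rho>))))
      = exp (- (y - 0)\<^sup>2 / (2 * (s\<^sup>2 * ((1 + \<rho>) / (1 - \<rho>))))) * exp (- (y - 0)\<^sup>2 / (2 * s\<^sup>2))"
    unfolding mult_exp_exp
    by (intro arg_cong[where f = exp]) (simp add: divide_simps, simp add: algebra_simps power2_eq_square)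
  have "(1 - \<rho>\<^sup>2) * (2 * pi * (s\<^sup>2 * ((1 + \<rho>) / (1 - \<rho>)))) * (2 * pi * s\<^sup>2) = (2 * pi * (s\<^sup>2 * (1 + \<rho>)))\<^sup>2"
    using pos by (simp add: field_simps power2_eq_square)
  then have "sqrt (1 - \<rho>\<^sup>2) * sqrt (2 * pi * (s\<^sup>2 * ((1 + \<rho>) / (1 - \<rho>)))) * sqrt (2 * pi * s\<^sup>2) = 2 * pi * (s\<^sup>2 * (1 + \<rho>))"
    unfolding real_sqrt_mult[symmetric] using pos by simp
  then have c: "(1 / sqrt (2 * pi * (s\<^sup>2 * (1 + \<rho>)))) * (1 / sqrt (2 * pi * (s\<^sup>2 * (1 + \<rho>))))
      = 1 / sqrt (1 - \<rho>\<^sup>2) * (1 / sqrt (2 * pi * (s\<^sup>2 * ((1 + \<rho>) / (1 - \<rho>))))) * (1 / sqrt (2 * pi * s\<^sup>2))"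
    using pos by (simp add: power2_eq_square[symmetric] power_divide)
  have "A * B * (A * B) = k * (C * D) * (E * F)" if "A * A = k * C * E" "B * B = D * F" for A B C D E F k :: real
    using that by algebra
  from this[OF c e] show ?thesis unfolding normal_density_def sq power2_eq_square[of "_ * exp _"] .
qed

lemma has_bochner_integral_normal_density:
  "0 < s \<Longrightarrow> has_bochner_integral lborel (normal_density a s) 1"
  by (simp add: has_bochner_integral_iff)

text \<open>The null density \<open>f0\<close> is \<open>N(0, s\<^sup>2)\<close> convolved with \<open>N(0, \<rho> s\<^sup>2)\<close>, and \<open>f1\<close> is
  \<open>N(0, s\<^sup>2)\<close> convolved with a discrete law on the points \<open>s \<sqrt>\<rho> u\<close>. Dividing by
  \<open>N(0, s\<^sup>2)\<close> instead of by the null density makes all integrals explicit.\<close>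

lemma has_integral_mixture_gap:
  fixes S :: "real set" and p :: "real \<Rightarrow> real"
  assumes s: "0 < s" and \<rho>: "0 \<le> \<rho>" "\<rho> < 1"
  defines "f1 \<equiv> \<lambda>y. \<Sum>u\<in>S. p u * normal_density (s * sqrt \<rho> * u) s y"
  defines "f0 \<equiv> normal_density 0 (s * sqrt (1 + \<rho>))"
  shows "has_bochner_integral lborel (\<lambda>y. (f1 y - f0 y)\<^sup>2 / normal_density 0 s y) (mixture_gap S p \<rho>)"
proof -
  let ?a = "\<lambda>u. s * sqrt \<rho> * u"
  let ?\<phi> = "normal_density 0 s"
  let ?h = "\<lambda>y. (\<Sum>u\<in>S. \<Sum>v\<in>S. p u * p v * exp (\<rho> * u * v) * normal_density (?a u + ?a v) s y)
    - 2 * (\<Sum>u\<in>S. p u * exp ((\<rho> * u)\<^sup>2 / 2) * normal_density (?a u * (1 + \<rho>)) (s * sqrt (1 + \<rho>)) y)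
    + 1 / sqrt (1 - \<rho>\<^sup>2) * normal_density 0 (s * sqrt ((1 + \<rho>) / (1 - \<rho>))) y"
  have eq: "(f1 y - f0 y)\<^sup>2 / ?\<phi> y = ?h y" for y
  proof -
    have pos: "0 < ?\<phi> y" using s by (rule normal_density_pos)
    have ab: "?a u * ?a v / s\<^sup>2 = \<rho> * u * v" "\<rho> * (?a u)\<^sup>2 / (2 * s\<^sup>2) = (\<rho> * u)\<^sup>2 / 2" for u v
      using s \<rho> by (simp_all add: power2_eq_square field_simps)
    \<comment> \<open>Fixed instances: as a rewrite rule the general formula for equal scales would apply to its own right-hand side.\<close>
    have n1: "normal_density (?a u) s y * normal_density (?a v) s y
        = exp (\<rho> * u * v) * (normal_density (?a u + ?a v) s y * ?\<phi> y)" for u v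
      using normal_density_mult_same_scale[OF s, of "?a u" y "?a v"] unfolding ab by (simp only: mult.assoc)
    have n2: "normal_density (?a u) s y * f0 y = exp ((\<rho> * u)\<^sup>2 / 2)
        * (normal_density (?a u * (1 + \<rho>)) (s * sqrt (1 + \<rho>)) y * ?\<phi> y)" for u
      using normal_density_mult_wider_scale[OF s \<rho>(1), of "?a u" y] unfolding ab f0_def by (simp only: mult.assoc)
    have 1: "(f1 y)\<^sup>2 = (\<Sum>u\<in>S. \<Sum>v\<in>S. p u * p v * exp (\<rho> * u * v) * normal_density (?a u + ?a v) s y) * ?\<phi> y"
    proof -
      have "(f1 y)\<^sup>2 = (\<Sum>u\<in>S. \<Sum>v\<in>S. p u * p v * (normal_density (?a u) s y * normal_density (?a v) s y))"
        by (simp add: f1_def power2_eq_square sum_product mult_ac)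
      then show ?thesis
        by (simp only: n1 sum_distrib_right) (simp only: mult.assoc)
    qed
    have 2: "f1 y * f0 y = (\<Sum>u\<in>S. p u * exp ((\<rho> * u)\<^sup>2 / 2) * normal_density (?a u * (1 + \<rho>)) (s * sqrt (1 + \<rho>)) y) * ?\<phi> y"
    proof -
      have "f1 y * f0 y = (\<Sum>u\<in>S. p u * (normal_density (?a u) s y * f0 y))"
        unfolding f1_def sum_distrib_right by (intro sum.cong refl) (rule mult.assoc)
      then show ?thesis by (simp only: n2 sum_distrib_right) (simp only: mult.assoc)
    qed
    have 3: "(f0 y)\<^sup>2 = 1 / sqrt (1 - \<rho>\<^sup>2) * normal_density 0 (s * sqrt ((1 + \<rho>) / (1 - \<rho>))) y * ?\<phi> y"
      unfolding f0_def by (rule normal_density_square_wider_scale[OF s \<rho>])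
    have "(f1 y - f0 y)\<^sup>2 = (f1 y)\<^sup>2 - 2 * (f1 y * f0 y) + (f0 y)\<^sup>2"
      by (simp add: power2_diff)
    also have "\<dots> = ?h y * ?\<phi> y" unfolding 1 2 3 by (simp only: distrib_right left_diff_distrib mult.assoc)
    finally show ?thesis using pos by simp
  qed
  have "has_bochner_integral lborel ?h
      ((\<Sum>u\<in>S. \<Sum>v\<in>S. p u * p v * exp (\<rho> * u * v) * 1)
        - 2 * (\<Sum>u\<in>S. p u * exp ((\<rho> * u)\<^sup>2 / 2) * 1) + 1 / sqrt (1 - \<rho>\<^sup>2) * 1)"
    using s \<rho>
    by (intro has_bochner_integral_add has_bochner_integral_diff has_bochner_integral_mult_right
        has_bochner_integral_sum has_bochner_integral_normal_density) auto
  then show ?thesis unfolding eq by (simp add: mixture_gap_def)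
qed

text \<open>The chi-square divergence from \<open>f0\<close>. The null density is the wider one, so that it dominates
  \<open>N(0, s\<^sup>2)\<close> up to the factor \<open>\<sqrt>(1 + \<rho>) \<le> 2\<close>.\<close>

lemma chi_square_le_mixture_gap:
  fixes S :: "real set" and p :: "real \<Rightarrow> real"
  assumes s: "0 < s" and \<rho>: "0 \<le> \<rho>" "\<rho> < 1" and p: "sum p S = 1"
  defines "f1 \<equiv> \<lambda>y. \<Sum>u\<in>S. p u * normal_density (s * sqrt \<rho> * u) s y"
  defines "f0 \<equiv> normal_density 0 (s * sqrt (1 + \<rho>))"
  shows "integrable lborel (\<lambda>y. (f1 y)\<^sup>2 / f0 y)"
    and "(\<integral>y. (f1 y)\<^sup>2 / f0 y \<partial>lborel) \<le> 1 + 2 * mixture_gap S p \<rho>"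
proof -
  let ?\<phi> = "normal_density 0 s"
  let ?d = "\<lambda>y. (f1 y - f0 y)\<^sup>2"
  have s': "0 < s * sqrt (1 + \<rho>)" using s \<rho> by simp
  have gap: "has_bochner_integral lborel (\<lambda>y. ?d y / ?\<phi> y) (mixture_gap S p \<rho>)"
    unfolding f1_def f0_def by (rule has_integral_mixture_gap[OF s \<rho>])
  have pos: "0 < f0 y" "0 < ?\<phi> y" for y
    unfolding f0_def using s s' by (auto intro: normal_density_pos)
  have "?\<phi> y \<le> 2 * f0 y" for y
  proof -
    have "exp (- (y - 0)\<^sup>2 / (2 * s\<^sup>2)) \<le> exp (- (y - 0)\<^sup>2 / (2 * (s\<^sup>2 * (1 + \<rho>))))"
    proof -
      have "(y - 0)\<^sup>2 / (2 * (s\<^sup>2 * (1 + \<rho>))) \<le> (y - 0)\<^sup>2 / (2 * s\<^sup>2)"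
        using s \<rho> mult_left_mono[of 1 "1 + \<rho>" "s\<^sup>2"] by (intro divide_left_mono) auto
      then show ?thesis by simp
    qed
    moreover have "1 / sqrt (2 * pi * s\<^sup>2) \<le> 2 * (1 / sqrt (2 * pi * (s\<^sup>2 * (1 + \<rho>))))"
    proof -
      have "sqrt (1 + \<rho>) \<le> 2" using \<rho> by (intro real_le_lsqrt) auto
      then show ?thesis using s \<rho> by (simp add: real_sqrt_mult divide_simps)
    qed
    ultimately have "1 / sqrt (2 * pi * s\<^sup>2) * exp (- (y - 0)\<^sup>2 / (2 * s\<^sup>2))
        \<le> 2 * (1 / sqrt (2 * pi * (s\<^sup>2 * (1 + \<rho>)))) * exp (- (y - 0)\<^sup>2 / (2 * (s\<^sup>2 * (1 + \<rho>))))"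
      using \<rho> by (intro mult_mono) auto
    then show ?thesis unfolding f0_def normal_density_def using \<rho> by (simp add: power_mult_distrib)
  qed
  then have le: "?d y / f0 y \<le> 2 * (?d y / ?\<phi> y)" for y
    using pos[of y] mult_left_mono[of "?\<phi> y" "2 * f0 y" "?d y"] by (simp add: divide_simps mult_ac)
  have [measurable]: "f1 \<in> borel_measurable borel" "f0 \<in> borel_measurable borel"
    unfolding f1_def f0_def by measurable
  have int_d: "integrable lborel (\<lambda>y. ?d y / f0 y)"
  proof (rule Bochner_Integration.integrable_bound)
    show int: "integrable lborel (\<lambda>y. 2 * (?d y / ?\<phi> y))"
      using gap by (intro integrable_mult_right) (simp add: has_bochner_integral_iff)
    show "AE y in lborel. norm (?d y / f0 y) \<le> norm (2 * (?d y / ?\<phi> y))"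
      using le pos by (auto simp: abs_of_pos)
  qed measurable
  have "(\<integral>y. ?d y / f0 y \<partial>lborel) \<le> (\<integral>y. 2 * (?d y / ?\<phi> y) \<partial>lborel)"
    using gap by (intro integral_mono int_d le integrable_mult_right) (simp add: has_bochner_integral_iff)
  also have "\<dots> = 2 * mixture_gap S p \<rho>"
    using gap by (subst integral_mult_right_zero) (simp add: has_bochner_integral_iff)
  finally have le_d: "(\<integral>y. ?d y / f0 y \<partial>lborel) \<le> 2 * mixture_gap S p \<rho>" .
  have "has_bochner_integral lborel f1 (\<Sum>u\<in>S. p u * 1)"
    unfolding f1_def using s
    by (intro has_bochner_integral_sum has_bochner_integral_mult_right has_bochner_integral_normal_density)
  then have f1: "has_bochner_integral lborel f1 1" by (simp add: p)
  have f0: "has_bochner_integral lborel f0 1" unfolding f0_def using s' by (rule has_bochner_integral_normal_density)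
  \<comment> \<open>Both densities integrate to one, so the linear part contributes exactly one.\<close>
  have "(f1 y)\<^sup>2 / f0 y = (2 * f1 y - f0 y) + ?d y / f0 y" for y
    using pos[of y] by (simp add: field_simps power2_eq_square)
  moreover have "has_bochner_integral lborel (\<lambda>y. (2 * f1 y - f0 y) + ?d y / f0 y)
      ((2 * 1 - 1) + (\<integral>y. ?d y / f0 y \<partial>lborel))"
    using int_d by (intro has_bochner_integral_add has_bochner_integral_diff has_bochner_integral_mult_right f1 f0)
      (simp add: has_bochner_integral_iff)
  ultimately have "has_bochner_integral lborel (\<lambda>y. (f1 y)\<^sup>2 / f0 y) (1 + (\<integral>y. ?d y / f0 y \<partial>lborel))" by simp
  then show "integrable lborel (\<lambda>y. (f1 y)\<^sup>2 / f0 y)" "(\<integral>y. (f1 y)\<^sup>2 / f0 y \<partial>lborel) \<le> 1 + 2 * mixture_gap S p \<rho>"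
    using le_d by (auto simp: has_bochner_integral_iff)
qed

section \<open>Product measures and second moments of likelihood ratios\<close>

lemma PiM_density:
  fixes g :: "'a \<Rightarrow> real"
  assumes "prob_space M" "prob_space (density M g)" and I: "finite I"
    and [measurable]: "g \<in> borel_measurable M" and g: "\<And>x. 0 \<le> g x"
  shows "(\<Pi>\<^sub>M i\<in>I. density M g) = density (\<Pi>\<^sub>M i\<in>I. M) (\<lambda>x. \<Prod>i\<in>I. g (x i))"
proof -
  interpret M: prob_space M by fact
  interpret N: prob_space "density M g" by fact
  interpret PM: product_sigma_finite "\<lambda>i. M" ..
  interpret PN: product_sigma_finite "\<lambda>i. density M g" ..
  show ?thesis
  proof (rule PN.PiM_eqI[symmetric, OF I])
    show "sets (density (\<Pi>\<^sub>M i\<in>I. M) (\<lambda>x. \<Prod>i\<in>I. g (x i))) = sets (\<Pi>\<^sub>M i\<in>I. density M g)"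
      by (simp cong: sets_PiM_cong)
    fix A assume A: "\<And>i. i \<in> I \<Longrightarrow> A i \<in> sets (density M g)"
    then have [measurable]: "\<And>i. i \<in> I \<Longrightarrow> A i \<in> sets M" by simp
    have "Pi\<^sub>E I A \<in> sets (\<Pi>\<^sub>M i\<in>I. M)" using I A by (intro sets_PiM_I_finite) auto
    then have "emeasure (density (\<Pi>\<^sub>M i\<in>I. M) (\<lambda>x. \<Prod>i\<in>I. g (x i))) (Pi\<^sub>E I A)
        = (\<integral>\<^sup>+x. ennreal (\<Prod>i\<in>I. g (x i)) * indicator (Pi\<^sub>E I A) x \<partial>(\<Pi>\<^sub>M i\<in>I. M))"
      by (simp add: emeasure_density)
    also have "\<dots> = (\<integral>\<^sup>+x. (\<Prod>i\<in>I. ennreal (g (x i)) * indicator (A i) (x i)) \<partial>(\<Pi>\<^sub>M i\<in>I. M))"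
    proof (rule nn_integral_cong)
      fix x assume x: "x \<in> space (\<Pi>\<^sub>M i\<in>I. M)"
      then have "(\<Prod>i\<in>I. indicator (A i) (x i)) = (indicator (Pi\<^sub>E I A) x :: ennreal)"
        using I by (auto simp: space_PiM PiE_iff indicator_def prod_eq_1_iff)
      then show "ennreal (\<Prod>i\<in>I. g (x i)) * indicator (Pi\<^sub>E I A) x
          = (\<Prod>i\<in>I. ennreal (g (x i)) * indicator (A i) (x i))"
        using g by (simp add: prod.distrib prod_ennreal)
    qed
    also have "\<dots> = (\<Prod>i\<in>I. \<integral>\<^sup>+x. ennreal (g x) * indicator (A i) x \<partial>M)"
      using I by (intro PM.product_nn_integral_prod) auto
    also have "\<dots> = (\<Prod>i\<in>I. emeasure (density M g) (A i))"
      by (intro prod.cong refl) (simp add: emeasure_density)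
    finally show "emeasure (density (\<Pi>\<^sub>M i\<in>I. M) (\<lambda>x. \<Prod>i\<in>I. g (x i))) (Pi\<^sub>E I A)
        = (\<Prod>i\<in>I. emeasure (density M g) (A i))" .
  qed
qed

text \<open>The second moment of a likelihood ratio is multiplicative over independent observations. If that
  of the product ratio \<open>G\<close> is at most \<open>1 + 1/16\<close>, its variance is at most \<open>1/16\<close>, and no event can gain
  more than \<open>E \<bar>G - 1\<bar> \<le> 1/4\<close>.\<close>

lemma prob_PiM_density_le:
  fixes g :: "'a \<Rightarrow> real"
  assumes M: "prob_space M" and N: "prob_space (density M g)"
    and [measurable]: "g \<in> borel_measurable M" and g: "\<And>x. 0 \<le> g x"
    and sq: "integrable M (\<lambda>x. (g x)\<^sup>2)" "(\<integral>x. (g x)\<^sup>2 \<partial>M) \<le> 1 + \<eta>"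
    and n: "(1 + \<eta>) ^ n \<le> 1 + 1 / 16"
    and A: "A \<in> sets (\<Pi>\<^sub>M i\<in>{..<n}. M)"
  shows "measure (\<Pi>\<^sub>M i\<in>{..<n}. density M g) A \<le> measure (\<Pi>\<^sub>M i\<in>{..<n}. M) A + 1 / 4"
proof -
  interpret M: prob_space M by fact
  interpret N: prob_space "density M g" by fact
  interpret PM: product_sigma_finite "\<lambda>i. M" ..
  define P where "P = (\<Pi>\<^sub>M i\<in>{..<n}. M)"
  interpret P: prob_space P unfolding P_def by (intro prob_space_PiM M)
  define G where "G x = (\<Prod>i<n. g (x i))" for x :: "nat \<Rightarrow> 'a"
  have [measurable]: "G \<in> borel_measurable P" unfolding G_def P_def by measurable
  have G0: "0 \<le> G x" for x unfolding G_def by (intro prod_nonneg) (use g in auto)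
  have [measurable]: "A \<in> sets P" using A by (simp add: P_def)
  have dens: "(\<Pi>\<^sub>M i\<in>{..<n}. density M g) = density P G"
    unfolding P_def G_def by (intro PiM_density M N g) auto
  have int_g: "has_bochner_integral M g 1"
  proof (rule has_bochner_integral_nn_integral)
    show "(\<integral>\<^sup>+x. ennreal (g x) \<partial>M) = ennreal 1"
      using N.emeasure_space_1 by (simp add: emeasure_density cong: nn_integral_cong)
  qed (use g in auto)
  have G1: "integrable P G" "(\<integral>x. G x \<partial>P) = 1"
  proof -
    have g: "integrable M g" "(\<integral>x. g x \<partial>M) = 1" using int_g by (auto simp: has_bochner_integral_iff)
    show "integrable P G" unfolding G_def P_def by (intro PM.product_integrable_prod g) auto
    show "(\<integral>x. G x \<partial>P) = 1" unfolding G_def P_def by (subst PM.product_integral_prod) (use g in auto)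
  qed
  have G_sq: "(G x)\<^sup>2 = (\<Prod>i<n. (g (x i))\<^sup>2)" for x unfolding G_def by (rule prod_power_distrib)
  have G2: "integrable P (\<lambda>x. (G x)\<^sup>2)" "(\<integral>x. (G x)\<^sup>2 \<partial>P) \<le> 1 + 1 / 16"
  proof -
    show "integrable P (\<lambda>x. (G x)\<^sup>2)" unfolding G_sq P_def by (intro PM.product_integrable_prod sq) auto
    have "(\<integral>x. (G x)\<^sup>2 \<partial>P) = (\<integral>x. (g x)\<^sup>2 \<partial>M) ^ n"
      unfolding G_sq P_def by (subst PM.product_integral_prod) (use sq in auto)
    also have "\<dots> \<le> (1 + \<eta>) ^ n" by (intro power_mono sq(2)) auto
    finally show "(\<integral>x. (G x)\<^sup>2 \<partial>P) \<le> 1 + 1 / 16" using n by simp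
  qed
  have "measure (density P G) A = (\<integral>x. indicator A x \<partial>density P G)" by simp
  also have "\<dots> = (\<integral>x. G x * indicator A x \<partial>P)"
    using G0 by (subst integral_density) auto
  also have "\<dots> \<le> (\<integral>x. indicator A x + (2 * ((G x)\<^sup>2 - 2 * G x + 1) + 1 / 8) \<partial>P)"
  proof (rule integral_mono)
    show "integrable P (\<lambda>x. G x * indicator A x)"
      using G1(1) by (rule Bochner_Integration.integrable_bound) (auto simp: indicator_def)
    show "integrable P (\<lambda>x. indicator A x + (2 * ((G x)\<^sup>2 - 2 * G x + 1) + 1 / 8))"
      using G1 G2 by (auto intro!: Bochner_Integration.integrable_add Bochner_Integration.integrable_diff
        integrable_mult_right integrable_real_indicator simp: P.emeasure_eq_measure)
    fix x
    \<comment> \<open>The inequality \<open>t \<le> 2 t\<^sup>2 + 1/8\<close> takes the place of Cauchy-Schwarz; it is sharp at \<open>t = 1/4\<close>,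
      the largest standard deviation that \<open>G\<close> can have.\<close>
    have "0 \<le> 2 * (G x - 1 - 1 / 4)\<^sup>2" by simp
    then have "G x - 1 \<le> 2 * (G x - 1)\<^sup>2 + 1 / 8" by (simp add: power2_eq_square algebra_simps)
    moreover have "(G x - 1)\<^sup>2 = (G x)\<^sup>2 - 2 * G x + 1" by (simp add: power2_eq_square algebra_simps)
    ultimately show "G x * indicator A x \<le> indicator A x + (2 * ((G x)\<^sup>2 - 2 * G x + 1) + 1 / 8)"
      using zero_le_power2[of "G x - 1"] by (auto simp: indicator_def)
  qed
  also have "\<dots> = measure P A + (2 * ((\<integral>x. (G x)\<^sup>2 \<partial>P) - 2 * (\<integral>x. G x \<partial>P) + 1) + 1 / 8)"
    using G1(1) G2(1) by (simp add: P.prob_space P.emeasure_eq_measure)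
  also have "\<dots> \<le> measure P A + 1 / 4" using G1(2) G2(2) by simp
  finally show ?thesis unfolding dens P_def .
qed

section \<open>Two-groups models with finitely supported contamination\<close>

lemma emeasure_gauss_shift:
  assumes [measurable]: "A \<in> sets borel"
  shows "emeasure (gauss 0 s) {a. a + c \<in> A} = emeasure (gauss c s) A"
proof -
  have [measurable]: "{a. a + c \<in> A} \<in> sets borel" by measurable
  have "normal_density c s (c + x) = normal_density 0 s x" for x
    by (simp add: normal_density_def)
  moreover have "emeasure (gauss c s) A = (\<integral>\<^sup>+x. ennreal (normal_density c s (c + 1 * x)) * indicator A (c + 1 * x) \<partial>lborel)"
    unfolding gauss_def by (subst emeasure_density, simp_all, subst nn_integral_real_affine[where c = 1 and t = c]) simp_all
  ultimately show ?thesis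
    unfolding gauss_def by (simp add: emeasure_density indicator_def add.commute)
qed

text \<open>The prior puts mass \<open>q u\<close> at the point \<open>b * u\<close>. The scaling is applied to the locations and kept out of \<open>q\<close>, so
  that one fixed moment-matched law can serve every scale.\<close>

lemma two_groups_finite_prior:
  fixes S :: "real set" and q :: "real \<Rightarrow> real"
  assumes S: "finite S" and q: "\<And>u. u \<in> S \<Longrightarrow> 0 \<le> q u" "sum q S = 1"
    and s: "0 < s" and \<epsilon>: "0 \<le> \<epsilon>" "\<epsilon> \<le> 1"
  shows "\<exists>Q \<in> space (prob_algebra borel). two_groups \<theta> s \<epsilon> Q =
    density lborel (\<lambda>y. (1 - \<epsilon>) * normal_density \<theta> s y + \<epsilon> * (\<Sum>u\<in>S. q u * normal_density (b * u) s y))"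
proof
  define P where "P = point_measure S (\<lambda>u. ennreal (q u))"
  define Q where "Q = distr P borel (\<lambda>u. b * u)"
  have meas: "(\<lambda>u. b * u) \<in> measurable P borel" by (simp add: P_def)
  have "prob_space P"
    by (rule prob_spaceI) (use S q in \<open>simp add: P_def space_point_measure emeasure_point_measure_finite\<close>)
  then have prob: "prob_space Q" unfolding Q_def using meas by (rule prob_space.prob_space_distr)
  then show Q: "Q \<in> space (prob_algebra borel)" by (simp add: space_prob_algebra Q_def)
  have setsQ: "sets Q = sets borel" by (simp add: Q_def)
  show "two_groups \<theta> s \<epsilon> Q =
    density lborel (\<lambda>y. (1 - \<epsilon>) * normal_density \<theta> s y + \<epsilon> * (\<Sum>u\<in>S. q u * normal_density (b * u) s y))"
    (is "_ = density lborel (\<lambda>y. ennreal (?f y))")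
  proof (rule measure_eqI)
    fix A assume "A \<in> sets (two_groups \<theta> s \<epsilon> Q)"
    then have A[measurable]: "A \<in> sets borel" by simp
    have fin: "finite_measure Q" "finite_measure (gauss 0 s)"
      using prob prob_space_gauss[OF s] by (auto intro: prob_space.finite_measure)
    have sp: "space Q = space borel" using setsQ by (rule sets_eq_imp_space_eq)
    have sets: "sets (convolution Q (gauss 0 s)) = sets (gauss \<theta> s)" by simp
    have emg: "emeasure (gauss a s) A = (\<integral>\<^sup>+y. ennreal (normal_density a s y) * indicator A y \<partial>lborel)" for a
      unfolding gauss_def by (simp add: emeasure_density)
    have "emeasure (convolution Q (gauss 0 s)) A = (\<integral>\<^sup>+x. emeasure (gauss 0 s) {a. a + x \<in> A} \<partial>Q)"
      using fin A setsQ sp by (intro convolution_emeasure) (auto simp: gauss_def)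
    also have "\<dots> = (\<integral>\<^sup>+x. emeasure (gauss x s) A \<partial>Q)"
      by (simp only: emeasure_gauss_shift[OF A])
    also have "\<dots> = (\<integral>\<^sup>+u. emeasure (gauss (b * u) s) A \<partial>P)"
    proof -
      have "(\<lambda>x. emeasure (gauss x s) A) \<in> borel_measurable borel"
        unfolding emg normal_density_def by measurable
      then show ?thesis unfolding Q_def by (intro nn_integral_distr meas) simp
    qed
    also have "\<dots> = (\<Sum>u\<in>S. ennreal (q u) * emeasure (gauss (b * u) s) A)"
      unfolding P_def using S by (subst nn_integral_point_measure_finite) (auto simp: mult.commute)
    finally have conv: "emeasure (convolution Q (gauss 0 s)) A = (\<Sum>u\<in>S. ennreal (q u) * emeasure (gauss (b * u) s) A)" .
    have "emeasure (two_groups \<theta> s \<epsilon> Q) A = ennreal (1 - \<epsilon>) * emeasure (gauss \<theta> s) A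
        + ennreal \<epsilon> * (\<Sum>u\<in>S. ennreal (q u) * emeasure (gauss (b * u) s) A)"
      unfolding two_groups_def using A sets by (subst emeasure_mixture) (auto simp: conv)
    also have "\<dots> = (\<integral>\<^sup>+y. ennreal (1 - \<epsilon>) * (ennreal (normal_density \<theta> s y) * indicator A y)
        + ennreal \<epsilon> * (\<Sum>u\<in>S. ennreal (q u) * (ennreal (normal_density (b * u) s y) * indicator A y)) \<partial>lborel)"
      unfolding emg by (simp add: nn_integral_add nn_integral_cmult nn_integral_sum)
    also have "\<dots> = (\<integral>\<^sup>+y. ennreal (?f y) * indicator A y \<partial>lborel)"
    proof (rule nn_integral_cong)
      fix y
      have "(\<Sum>u\<in>S. ennreal (q u) * ennreal (normal_density (b * u) s y)) = ennreal (\<Sum>u\<in>S. q u * normal_density (b * u) s y)"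
        using q by (subst sum_ennreal[symmetric]) (auto simp: ennreal_mult)
      then have "ennreal (?f y) = ennreal (1 - \<epsilon>) * ennreal (normal_density \<theta> s y)
          + ennreal \<epsilon> * (\<Sum>u\<in>S. ennreal (q u) * ennreal (normal_density (b * u) s y))"
        using \<epsilon> q by (subst ennreal_plus) (auto simp: ennreal_mult sum_nonneg)
      then show "ennreal (1 - \<epsilon>) * (ennreal (normal_density \<theta> s y) * indicator A y)
        + ennreal \<epsilon> * (\<Sum>u\<in>S. ennreal (q u) * (ennreal (normal_density (b * u) s y) * indicator A y)) = ennreal (?f y) * indicator A y"
        by (simp split: split_indicator)
    qed
    also have "\<dots> = emeasure (density lborel (\<lambda>y. ennreal (?f y))) A"
      by (simp add: emeasure_density)
    finally show "emeasure (two_groups \<theta> s \<epsilon> Q) A = emeasure (density lborel (\<lambda>y. ennreal (?f y))) A" .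
  qed simp
qed

section \<open>Intervals that cover two points\<close>

lemma interval_length_ge:
  assumes "a \<in> I" "b \<in> I"
  shows "ereal (b - a) \<le> interval_length I"
proof -
  have "ereal b - ereal a \<le> (SUP x\<in>I. ereal x) - (INF x\<in>I. ereal x)"
    by (intro ereal_minus_mono SUP_upper INF_lower assms)
  then show ?thesis by (simp add: interval_length_def)
qed

text \<open>An infimum of reals is a lower bound only of a set that is bounded below; nonnegativity
  provides that at both levels.\<close>

lemma le_of_le_nested_INF:
  fixes f :: "'a \<Rightarrow> 'b \<Rightarrow> 'c \<Rightarrow> 'd \<Rightarrow> real"
  assumes le: "b \<le> (INF (\<theta>, \<sigma>)\<in>A. INF (\<epsilon>, Q)\<in>B. f \<theta> \<sigma> \<epsilon> Q)"
    and nonneg: "\<And>\<theta> \<sigma> \<epsilon> Q. 0 \<le> f \<theta> \<sigma> \<epsilon> Q"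
    and "(\<theta>, \<sigma>) \<in> A" "(\<epsilon>, Q) \<in> B"
  shows "b \<le> f \<theta> \<sigma> \<epsilon> Q"
proof -
  let ?g = "\<lambda>\<theta> \<sigma>. INF (\<epsilon>, Q)\<in>B. f \<theta> \<sigma> \<epsilon> Q"
  have g: "0 \<le> ?g \<theta> \<sigma>" for \<theta> \<sigma>
    using assms(4) nonneg by (intro cINF_greatest) auto
  have "b \<le> (INF (\<theta>, \<sigma>)\<in>A. ?g \<theta> \<sigma>)" by (rule le)
  also have "\<dots> \<le> (case (\<theta>, \<sigma>) of (\<theta>, \<sigma>) \<Rightarrow> ?g \<theta> \<sigma>)"
    using assms(3) g by (intro cINF_lower bdd_belowI[of _ 0]) auto
  also have "\<dots> = ?g \<theta> \<sigma>" by simp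
  also have "\<dots> \<le> (case (\<epsilon>, Q) of (\<epsilon>, Q) \<Rightarrow> f \<theta> \<sigma> \<epsilon> Q)"
    using assms(4) nonneg by (intro cINF_lower bdd_belowI[of _ 0]) auto
  finally show ?thesis by simp
qed

text \<open>The three events have total probability more than two, so some sample lies in all of them.\<close>

lemma confidence_interval_length_ge:
  assumes CI: "confidence_interval n CI" and P: "prob_space P" "sets P = sets (\<Pi>\<^sub>M i\<in>{..<n}. borel)"
    and c1: "1 - \<delta> \<le> \<P>(x in P. a \<in> CI x)" and c2: "3 / 4 - \<delta> \<le> \<P>(x in P. b \<in> CI x)"
    and len: "1 - \<delta> \<le> \<P>(x in P. interval_length (CI x) \<le> ereal r)" and \<delta>: "\<delta> < 1 / 4"
  shows "b - a \<le> r"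
proof -
  interpret prob_space P by fact
  have sp: "space P = space (\<Pi>\<^sub>M i\<in>{..<n}. borel)" using P(2) by (rule sets_eq_imp_space_eq)
  have ev: "{x \<in> space P. \<theta> \<in> CI x} \<in> events" for \<theta>
    using CI by (simp add: confidence_interval_def P(2) sp)
  have "(\<lambda>x. interval_length (CI x)) \<in> borel_measurable P"
    using CI P(2) by (simp add: confidence_interval_def cong: measurable_cong_sets)
  then have ev_len: "{x \<in> space P. interval_length (CI x) \<le> ereal r} \<in> events" by measurable
  let ?A = "{x \<in> space P. a \<in> CI x}" and ?B = "{x \<in> space P. b \<in> CI x}"
  let ?L = "{x \<in> space P. interval_length (CI x) \<le> ereal r}"
  have "?A \<inter> ?B \<inter> ?L \<noteq> {}"
  proof
    assume "?A \<inter> ?B \<inter> ?L = {}"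
    then have "space P = (space P - ?A) \<union> (space P - ?B) \<union> (space P - ?L)" by auto
    then have "1 = prob ((space P - ?A) \<union> (space P - ?B) \<union> (space P - ?L))"
      using prob_space by simp
    also have "\<dots> \<le> prob (space P - ?A) + prob (space P - ?B) + prob (space P - ?L)"
      using ev ev_len
      by (intro order_trans[OF measure_Un_le] add_right_mono measure_Un_le) auto
    also have "\<dots> = (1 - prob ?A) + (1 - prob ?B) + (1 - prob ?L)"
      using ev ev_len by (simp add: prob_compl)
    finally show False using c1 c2 len \<delta> by linarith
  qed
  then obtain x where "a \<in> CI x" "b \<in> CI x" "interval_length (CI x) \<le> ereal r" by auto
  with interval_length_ge[of a "CI x" b] have "ereal (b - a) \<le> ereal r" by (meson order_trans)
  then show ?thesis by simp
qed

section \<open>Indistinguishable models and the lower bound\<close>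

text \<open>The point \<open>x\<close> may already belong to \<open>S\<close>, in which case the two masses add up.\<close>

lemma sum_insert_atom:
  fixes S :: "real set" and q F :: "real \<Rightarrow> real"
  assumes "finite S"
  shows "(\<Sum>u\<in>insert x S. ((if u = x then w else 0) + (if u \<in> S then e * q u else 0)) * F u)
    = w * F x + e * (\<Sum>u\<in>S. q u * F u)"
proof -
  have "(\<Sum>u\<in>insert x S. ((if u = x then w else 0) + (if u \<in> S then e * q u else 0)) * F u)
      = (\<Sum>u\<in>insert x S. if u = x then w * F u else 0) + (\<Sum>u\<in>insert x S. if u \<in> S then e * q u * F u else 0)"
    unfolding sum.distrib[symmetric] by (intro sum.cong) (auto simp: distrib_right)
  also have "(\<Sum>u\<in>insert x S. if u \<in> S then e * q u * F u else 0) = (\<Sum>u\<in>S. e * q u * F u)"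
    using assms(1) by (intro sum.mono_neutral_cong_right) auto
  finally show ?thesis using assms(1) by (simp add: sum_distrib_left mult.assoc)
qed

text \<open>The alternative is centred at the atom \<open>s * sqrt \<rho> * x\<close> and has noise level \<open>s\<close>, instead of the level
  \<open>s * sqrt (1 + \<rho>)\<close> of the null: its contamination spreads the data as the missing noise would.\<close>

lemma confusable_alternative:
  fixes S :: "real set" and q :: "real \<Rightarrow> real" and e x :: real
  assumes S: "finite S" and q: "\<And>u. u \<in> S \<Longrightarrow> 0 \<le> q u" "sum q S = 1"
    and e: "0 \<le> e" "e \<le> 1" and s: "0 < s" and \<rho>: "0 \<le> \<rho>" "\<rho> < 1"
  defines "p \<equiv> \<lambda>u. (if u = x then 1 - e else 0) + (if u \<in> S then e * q u else 0)"
  assumes n: "(1 + 2 * mixture_gap (insert x S) p \<rho>) ^ n \<le> 1 + 1 / 16"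
  shows "\<exists>Q \<in> space (prob_algebra borel). \<forall>A \<in> sets (\<Pi>\<^sub>M i\<in>{..<n}. borel).
    measure (two_groups_sample n (s * sqrt \<rho> * x) s e Q) A
      \<le> measure (\<Pi>\<^sub>M i\<in>{..<n}. gauss 0 (s * sqrt (1 + \<rho>))) A + 1 / 4"
proof -
  let ?f1 = "\<lambda>y. \<Sum>u\<in>insert x S. p u * normal_density (s * sqrt \<rho> * u) s y"
  let ?f0 = "normal_density 0 (s * sqrt (1 + \<rho>))"
  let ?M = "gauss 0 (s * sqrt (1 + \<rho>))"
  define g where "g y = ?f1 y / ?f0 y" for y
  have s': "0 < s * sqrt (1 + \<rho>)" using s \<rho> by simp
  have f0: "0 < ?f0 y" for y using s' by (rule normal_density_pos)
  have p0: "0 \<le> p u" for u unfolding p_def using e q by auto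
  have f1: "0 \<le> ?f1 y" for y using p0 by (intro sum_nonneg) auto
  have psum: "sum p (insert x S) = 1"
    using sum_insert_atom[OF S, of x "1 - e" e q "\<lambda>_. 1"] q(2) by (simp add: p_def)
  obtain Q where Q: "Q \<in> space (prob_algebra borel)"
    and tg: "two_groups (s * sqrt \<rho> * x) s e Q = density lborel (\<lambda>y.
        (1 - e) * normal_density (s * sqrt \<rho> * x) s y + e * (\<Sum>u\<in>S. q u * normal_density (s * sqrt \<rho> * u) s y))"
    using two_groups_finite_prior[OF S q s e, of "s * sqrt \<rho> * x" "s * sqrt \<rho>"] by blast
  have tg1: "two_groups (s * sqrt \<rho> * x) s e Q = density lborel ?f1"
    unfolding tg p_def sum_insert_atom[OF S] ..
  have [measurable]: "g \<in> borel_measurable borel" unfolding g_def by measurable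
  have dens: "two_groups (s * sqrt \<rho> * x) s e Q = density ?M g"
    unfolding tg1 gauss_def
    by (subst density_density_eq) (use f0 f1 in \<open>auto intro!: density_cong simp: g_def ennreal_mult[symmetric] less_imp_le less_imp_neq[symmetric]\<close>)
  have M: "prob_space ?M" using s' by (rule prob_space_gauss)
  have N: "prob_space (density ?M g)"
    unfolding dens[symmetric] by (rule prob_space_two_groups[OF s e Q])
  have sq: "?f0 y * (g y)\<^sup>2 = (?f1 y)\<^sup>2 / ?f0 y" for y
    using f0[of y] by (simp add: g_def power2_eq_square)
  have int: "integrable ?M (\<lambda>y. (g y)\<^sup>2)"
    unfolding gauss_def using chi_square_le_mixture_gap(1)[OF s \<rho> psum]
    by (subst integrable_density) (use f0 in \<open>auto simp: sq less_imp_le\<close>)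
  have le: "(\<integral>y. (g y)\<^sup>2 \<partial>?M) \<le> 1 + 2 * mixture_gap (insert x S) p \<rho>"
    unfolding gauss_def using chi_square_le_mixture_gap(2)[OF s \<rho> psum]
    by (subst integral_density) (use f0 in \<open>auto simp: sq less_imp_le\<close>)
  have "measure (two_groups_sample n (s * sqrt \<rho> * x) s e Q) A \<le> measure (\<Pi>\<^sub>M i\<in>{..<n}. ?M) A + 1 / 4"
    if "A \<in> sets (\<Pi>\<^sub>M i\<in>{..<n}. borel)" for A
    unfolding two_groups_sample_def dens
  proof (rule prob_PiM_density_le[OF M N _ _ int le n])
    show "A \<in> sets (\<Pi>\<^sub>M i\<in>{..<n}. ?M)" using that by (simp cong: sets_PiM_cong)
    show "0 \<le> g y" for y using f0[of y] f1[of y] by (simp add: g_def)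
  qed simp
  then show ?thesis using Q by blast
qed

text \<open>Matching \<open>k - 1 = 2 m + 1\<close> moments makes the one-sample divergence of order \<open>\<rho>\<^sup>k\<close>, so \<open>\<rho>\<close> can be
  as large as a constant times \<open>n\<close> to the power \<open>-1/k\<close>, while the centre moves by a multiple of
  \<open>\<sigma> * sqrt \<rho>\<close>.\<close>

lemma confusable_alternatives_rate:
  fixes e :: real
  assumes card: "CARD('n::finite) = 2 * m + 1" and m: "m \<le> 5" and e: "0 < e" "e < 1"
    and chr: "(1 - e) * hermite_kernel m 0 < 1"
  shows "\<exists>c>0. \<forall>n\<ge>1. \<forall>\<sigma>>0. \<exists>\<theta> s Q. c * \<sigma> * real n powr (- 1 / real (4 * m + 4)) \<le> \<theta> \<and> 0 < s \<and>
    Q \<in> space (prob_algebra borel) \<and> (\<forall>A \<in> sets (\<Pi>\<^sub>M i\<in>{..<n}. borel).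
      measure (two_groups_sample n \<theta> s e Q) A \<le> measure (\<Pi>\<^sub>M i\<in>{..<n}. gauss 0 \<sigma>) A + 1 / 4)"
proof -
  obtain x where x: "0 < x" "(1 - e) * hermite_kernel m x < 1"
    using nonzero_node_exists[OF chr] by auto
  obtain S q where S: "finite S" and q: "\<And>u. u \<in> S \<Longrightarrow> 0 \<le> q u" "sum q S = 1"
    and mom: "\<And>j. j \<le> 2 * m + 1 \<Longrightarrow> (1 - e) * x ^ j + e * (\<Sum>u\<in>S. q u * u ^ j) = gauss_moment j"
    using gauss_moments_with_atom[OF card m, of "1 - e" x] e x by auto
  define p where "p = (\<lambda>u. (if u = x then 1 - e else 0) + (if u \<in> S then e * q u else 0))"
  define k where "k = 2 * m + 2"
  have mom': "(\<Sum>u\<in>insert x S. p u * u ^ j) = gauss_moment j" if "j < k" for j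
    unfolding p_def sum_insert_atom[OF S] using mom[of j] that by (simp add: k_def)
  define K where "K = mixture_gap (insert x S) p (1 / 2)"
  have K: "0 \<le> K" unfolding K_def by (rule mixture_gap_bounds[OF mom']) auto
  \<comment> \<open>Chosen such that the divergence is at most \<open>1 / (32 n)\<close>, and \<open>exp (1/32) \<le> 1 + 1/16\<close>.\<close>
  define c0 where "c0 = 1 / (128 * (K + 1))"
  have c0: "0 < c0" "2 * c0 \<le> 1" "2 * (2 * c0 * K) \<le> 1 / 32" using K by (auto simp: c0_def field_simps)
  show ?thesis
  proof (rule exI[of _ "x * sqrt c0 / 2"], intro conjI allI impI)
    show "0 < x * sqrt c0 / 2" using x c0 by simp
    fix n :: nat and \<sigma> :: real assume n: "1 \<le> n" and \<sigma>: "0 < \<sigma>"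
    define \<rho> where "\<rho> = c0 * real n powr (- 1 / real k)"
    have npow: "0 < real n powr (- 1 / real k)" "real n powr (- 1 / real k) \<le> 1"
      using n powr_mono[of "- 1 / real k" 0 "real n"] by auto
    then have \<rho>: "0 < \<rho>" "\<rho> \<le> 1 / 2" using c0 mult_mono[of c0 "1/2" "real n powr (- 1 / real k)" 1] by (auto simp: \<rho>_def)
    have "(real n powr (- 1 / real k)) ^ k = 1 / real n"
    proof -
      have "(real n powr (- 1 / real k)) ^ k = real n powr (- 1 / real k * real k)"
        using npow(1) by (simp only: powr_realpow[symmetric] powr_powr)
      also have "- 1 / real k * real k = - 1" by (simp add: k_def)
      finally show ?thesis using n powr_minus_divide[of "real n" 1] by simp
    qed
    then have \<rho>k: "(2 * \<rho>) ^ k = (2 * c0) ^ k / real n"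
      by (simp add: \<rho>_def power_mult_distrib)
    let ?gap = "mixture_gap (insert x S) p \<rho>"
    have gap0: "0 \<le> ?gap" by (rule mixture_gap_bounds[OF mom']) (use \<rho> in auto)
    have "?gap \<le> (2 * \<rho>) ^ k * K" unfolding K_def by (rule mixture_gap_bounds[OF mom']) (use \<rho> in auto)
    also have "\<dots> \<le> 2 * c0 * K / real n"
    proof -
      have "(2 * c0) ^ k \<le> 2 * c0" using power_decreasing[of 1 k "2 * c0"] c0 by (simp add: k_def)
      then show ?thesis unfolding \<rho>k using K n by (simp add: divide_right_mono mult_right_mono)
    qed
    finally have "real n * (2 * ?gap) \<le> 2 * (2 * c0 * K)" using n by (simp add: field_simps)
    with c0(3) have ngap: "real n * (2 * ?gap) \<le> 1 / 32" by linarith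
    have "(1 + 2 * ?gap) ^ n \<le> exp (2 * ?gap) ^ n" using gap0 by (intro power_mono) auto
    also have "\<dots> = exp (real n * (2 * ?gap))" by (simp add: exp_of_nat_mult)
    also have "\<dots> \<le> exp (1 / 32)" using ngap by simp
    also have "\<dots> \<le> 1 + 1 / 32 + (1 / 32)\<^sup>2" by (rule exp_bound) auto
    also have "\<dots> \<le> 1 + 1 / 16" by (simp add: power2_eq_square)
    finally have small: "(1 + 2 * ?gap) ^ n \<le> 1 + 1 / 16" .
    define s where "s = \<sigma> / sqrt (1 + \<rho>)"
    have s: "0 < s" "s * sqrt (1 + \<rho>) = \<sigma>" using \<sigma> \<rho> by (simp_all add: s_def)
    have "sqrt (1 + \<rho>) \<le> 2" using \<rho> by (intro real_le_lsqrt) auto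
    then have s_ge: "\<sigma> / 2 \<le> s" unfolding s_def using \<sigma> \<rho> by (intro divide_left_mono) auto
    have "sqrt (real n powr (- 1 / real k)) = real n powr (- 1 / real (4 * m + 4))"
      unfolding powr_half_sqrt[OF less_imp_le[OF npow(1)], symmetric] powr_powr by (simp add: k_def field_simps)
    then have "x * sqrt c0 / 2 * \<sigma> * real n powr (- 1 / real (4 * m + 4)) = \<sigma> / 2 * sqrt \<rho> * x"
      by (simp add: \<rho>_def real_sqrt_mult)
    also have "\<dots> \<le> s * sqrt \<rho> * x" using s_ge \<rho> x by (intro mult_right_mono) auto
    finally have "x * sqrt c0 / 2 * \<sigma> * real n powr (- 1 / real (4 * m + 4)) \<le> s * sqrt \<rho> * x" .
    with confusable_alternative[OF S q _ _ s(1), of e \<rho> x n] small e \<rho> s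
    show "\<exists>\<theta> s Q. x * sqrt c0 / 2 * \<sigma> * real n powr (- 1 / real (4 * m + 4)) \<le> \<theta> \<and> 0 < s \<and>
      Q \<in> space (prob_algebra borel) \<and> (\<forall>A \<in> sets (\<Pi>\<^sub>M i\<in>{..<n}. borel).
      measure (two_groups_sample n \<theta> s e Q) A \<le> measure (\<Pi>\<^sub>M i\<in>{..<n}. gauss 0 \<sigma>) A + 1 / 4)"
      unfolding p_def by auto
  qed
qed

text \<open>Contamination located at the centre is invisible. Hence uncontaminated data are possible under every \<open>\<epsilon>\<close>,
  and the length guarantee at \<open>\<epsilon>\<close> applies to them.\<close>

lemma gauss_is_two_groups:
  assumes "0 < \<sigma>" "0 \<le> \<epsilon>" "\<epsilon> \<le> 1"
  shows "\<exists>Q \<in> space (prob_algebra borel). two_groups 0 \<sigma> \<epsilon> Q = gauss 0 \<sigma>"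
proof -
  have "(1 - \<epsilon>) * z + \<epsilon> * z = z" for z :: real by (simp add: algebra_simps)
  then show ?thesis
    using two_groups_finite_prior[of "{0}" "\<lambda>_. 1" \<sigma> \<epsilon> 0 0] assms by (simp add: gauss_def)
qed

text \<open>Coverage under the alternative carries over to the pure data at the cost of \<open>1/4\<close>, so on pure data
  the interval covers both centres.\<close>

lemma confidence_interval_length_rate:
  fixes \<delta> \<epsilon>max :: real
  assumes \<delta>: "\<delta> < 1 / 4" and e: "0 < \<epsilon>max" "\<epsilon>max < 1" and card: "CARD('n::finite) = 2 * m + 1" and m: "m \<le> 5"
    and chr: "(1 - \<epsilon>max) * hermite_kernel m 0 < 1"
  shows "\<exists>c>0. \<forall>(n::nat) (CI :: (nat \<Rightarrow> real) \<Rightarrow> real set) (r :: nat \<Rightarrow> real \<Rightarrow> real \<Rightarrow> real).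
    1 \<le> n \<longrightarrow>
    confidence_interval n CI \<longrightarrow>
    (INF (\<theta>, \<sigma>)\<in>UNIV \<times> {0<..}. INF (\<epsilon>, Q)\<in>{0..\<epsilon>max} \<times> space (prob_algebra borel).
       \<P>(x in two_groups_sample n \<theta> \<sigma> \<epsilon> Q. \<theta> \<in> CI x)) \<ge> 1 - \<delta> \<longrightarrow>
    (INF (\<theta>, \<sigma>)\<in>UNIV \<times> {0<..}. INF (\<epsilon>, Q)\<in>{0..\<epsilon>max} \<times> space (prob_algebra borel).
       \<P>(x in two_groups_sample n \<theta> \<sigma> \<epsilon> Q. interval_length (CI x) \<le> ereal (r n \<sigma> \<epsilon>))) \<ge> 1 - \<delta> \<longrightarrow>
    (\<forall>\<sigma>>0. \<forall>\<epsilon>\<in>{0..\<epsilon>max}. c * \<sigma> * real n powr (- 1 / real (4 * m + 4)) \<le> r n \<sigma> \<epsilon>)"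
proof -
  obtain c where c: "0 < c" and alt: "\<forall>n\<ge>1. \<forall>\<sigma>>0. \<exists>\<theta> s Q. c * \<sigma> * real n powr (- 1 / real (4 * m + 4)) \<le> \<theta> \<and> 0 < s \<and>
    Q \<in> space (prob_algebra borel) \<and> (\<forall>A \<in> sets (\<Pi>\<^sub>M i\<in>{..<n}. borel).
      measure (two_groups_sample n \<theta> s \<epsilon>max Q) A \<le> measure (\<Pi>\<^sub>M i\<in>{..<n}. gauss 0 \<sigma>) A + 1 / 4)"
    using confusable_alternatives_rate[OF card m e chr] by blast
  show ?thesis
  proof (intro exI[of _ c] conjI c allI impI ballI)
    fix n :: nat and CI :: "(nat \<Rightarrow> real) \<Rightarrow> real set" and r :: "nat \<Rightarrow> real \<Rightarrow> real \<Rightarrow> real" and \<sigma> \<epsilon> :: real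
    assume n: "1 \<le> n" and CI: "confidence_interval n CI"
      and cover: "1 - \<delta> \<le> (INF (\<theta>, \<sigma>)\<in>UNIV \<times> {0<..}. INF (\<epsilon>, Q)\<in>{0..\<epsilon>max} \<times> space (prob_algebra borel).
       \<P>(x in two_groups_sample n \<theta> \<sigma> \<epsilon> Q. \<theta> \<in> CI x))"
      and len: "1 - \<delta> \<le> (INF (\<theta>, \<sigma>)\<in>UNIV \<times> {0<..}. INF (\<epsilon>, Q)\<in>{0..\<epsilon>max} \<times> space (prob_algebra borel).
       \<P>(x in two_groups_sample n \<theta> \<sigma> \<epsilon> Q. interval_length (CI x) \<le> ereal (r n \<sigma> \<epsilon>)))"
      and \<sigma>: "0 < \<sigma>" and \<epsilon>: "\<epsilon> \<in> {0..\<epsilon>max}"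
    note cover' = le_of_le_nested_INF[where f = "\<lambda>\<theta> \<sigma> \<epsilon> Q. \<P>(x in two_groups_sample n \<theta> \<sigma> \<epsilon> Q. \<theta> \<in> CI x)",
        OF cover measure_nonneg]
    note len' = le_of_le_nested_INF[where f = "\<lambda>\<theta> \<sigma> \<epsilon> Q. \<P>(x in two_groups_sample n \<theta> \<sigma> \<epsilon> Q. interval_length (CI x) \<le> ereal (r n \<sigma> \<epsilon>))",
        OF len measure_nonneg]
    obtain Q0 where Q0: "Q0 \<in> space (prob_algebra borel)" and tg0: "two_groups 0 \<sigma> \<epsilon> Q0 = gauss 0 \<sigma>"
      using gauss_is_two_groups[of \<sigma> \<epsilon>] \<sigma> \<epsilon> e by auto
    obtain \<theta> s Q1 where \<theta>: "c * \<sigma> * real n powr (- 1 / real (4 * m + 4)) \<le> \<theta>" and s: "0 < s"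
      and Q1: "Q1 \<in> space (prob_algebra borel)"
      and close: "\<And>A. A \<in> sets (\<Pi>\<^sub>M i\<in>{..<n}. borel) \<Longrightarrow> measure (two_groups_sample n \<theta> s \<epsilon>max Q1) A
        \<le> measure (two_groups_sample n 0 \<sigma> \<epsilon> Q0) A + 1 / 4"
      using alt[rule_format, OF n \<sigma>] unfolding two_groups_sample_def tg0 by blast
    let ?P0 = "two_groups_sample n 0 \<sigma> \<epsilon> Q0" and ?P1 = "two_groups_sample n \<theta> s \<epsilon>max Q1"
    have sp: "space (two_groups_sample n \<theta> \<sigma> \<epsilon> Q) = space (\<Pi>\<^sub>M i\<in>{..<n}. borel)" for \<theta> \<sigma> \<epsilon> Q
      by (rule sets_eq_imp_space_eq) simp
    have "\<theta> - 0 \<le> r n \<sigma> \<epsilon>"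
    proof (rule confidence_interval_length_ge[OF CI])
      show "prob_space ?P0" using \<sigma> \<epsilon> e Q0 by (intro prob_space_two_groups_sample) auto
      show "1 - \<delta> \<le> \<P>(x in ?P0. 0 \<in> CI x)" using \<sigma> \<epsilon> Q0 by (intro cover') auto
      show "1 - \<delta> \<le> \<P>(x in ?P0. interval_length (CI x) \<le> ereal (r n \<sigma> \<epsilon>))" using \<sigma> \<epsilon> Q0 by (intro len') auto
      have "1 - \<delta> \<le> \<P>(x in ?P1. \<theta> \<in> CI x)" using s e Q1 by (intro cover') auto
      also have "\<dots> \<le> \<P>(x in ?P0. \<theta> \<in> CI x) + 1 / 4"
        unfolding sp using CI by (intro close) (simp add: confidence_interval_def)
      finally show "3 / 4 - \<delta> \<le> \<P>(x in ?P0. \<theta> \<in> CI x)" by simp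
    qed (use \<delta> in simp_all)
    with \<theta> show "c * \<sigma> * real n powr (- 1 / real (4 * m + 4)) \<le> r n \<sigma> \<epsilon>" by simp
  qed
qed

theorem theorem5:
  fixes \<delta> \<epsilon>max :: real
  assumes "\<delta> \<in> {0<..<1/4}" and "\<epsilon>max \<in> {1/3<..<1/2}"
  shows "\<exists>c>0. \<forall>(n::nat) (CI :: (nat \<Rightarrow> real) \<Rightarrow> real set) (r :: nat \<Rightarrow> real \<Rightarrow> real \<Rightarrow> real).
    1 \<le> n \<longrightarrow>
    confidence_interval n CI \<longrightarrow>
    (INF (\<theta>, \<sigma>)\<in>UNIV \<times> {0<..}. INF (\<epsilon>, Q)\<in>{0..\<epsilon>max} \<times> space (prob_algebra borel).
       \<P>(x in two_groups_sample n \<theta> \<sigma> \<epsilon> Q. \<theta> \<in> CI x)) \<ge> 1 - \<delta> \<longrightarrow>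
    (INF (\<theta>, \<sigma>)\<in>UNIV \<times> {0<..}. INF (\<epsilon>, Q)\<in>{0..\<epsilon>max} \<times> space (prob_algebra borel).
       \<P>(x in two_groups_sample n \<theta> \<sigma> \<epsilon> Q. interval_length (CI x) \<le> ereal (r n \<sigma> \<epsilon>))) \<ge> 1 - \<delta> \<longrightarrow>
    (\<forall>\<sigma>>0. \<forall>\<epsilon>\<in>{0..\<epsilon>max}.
       r n \<sigma> \<epsilon> \<ge> (if \<epsilon>max \<le> 7/15 then c * \<sigma> * real n powr (-1/16)
                              else c * \<sigma> * real n powr (-1/24)))"
proof (cases "\<epsilon>max \<le> 7/15")
  case True
  have "(1 - \<epsilon>max) * hermite_kernel 3 0 < 1"
    using assms(2) by (simp add: hermite_kernel_at_0)
  \<comment> \<open>The kernel at \<open>0\<close> is \<open>3/2\<close>, whence the threshold \<open>1/3\<close>; the exponent is \<open>1 / (4 * 3 + 4)\<close>.\<close>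
  with confidence_interval_length_rate[where 'n = 7 and m = 3, of \<delta> \<epsilon>max] True assms show ?thesis by simp
next
  case False
  have "(1 - \<epsilon>max) * hermite_kernel 5 0 < 1"
    using False by (simp add: hermite_kernel_at_0)
  \<comment> \<open>The kernel at \<open>0\<close> is \<open>15/8\<close>, whence the threshold \<open>7/15\<close>; the exponent is \<open>1 / (4 * 5 + 4)\<close>.\<close>
  with confidence_interval_length_rate[where 'n = 11 and m = 5, of \<delta> \<epsilon>max] False assms show ?thesis by simp
qed

end
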